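(* Let $A_1,A_2\in\mathbb{R}^{n\times n}$, $e_1,e_2,c\in\mathbb{R}^n$ and $f\in\mathbb{R}$, and consider the bimodal piecewise affine system determined by these data (see context). If there exists a $2\times2$ lower triangular matrix $M$ with positive diagonal elements such that $$\begin{bmatrix}c^T\\ c^TA_1\end{bmatrix}=M\begin{bmatrix}c^T\\ c^TA_2\end{bmatrix},\qquad \begin{bmatrix}f\\ c^Te_1\end{bmatrix}\succ M\begin{bmatrix}f\\ c^Te_2\end{bmatrix},$$ then right-uniqueness of Filippov solutions holds at any state of the state space, i.e. for every $\xi\in\mathbb{R}^n$, every Filippov solution for the initial state $\xi$ is right-unique.
   Context: Define the set-valued mapping $G(x)=\{A_1x+e_1\}$ if $c^Tx+f<0$, $G(x)=\operatorname{conv}\{A_1x+e_1,A_2x+e_2\}$ if $c^Tx+f=0$, $G(x)=\{A_2x+e_2\}$ if $c^Tx+f>0$. A function $x:\mathbb{R}\to\mathbb{R}^n$, absolutely continuous on every compact interval, is a Filippov solution for the initial state $\xi$ if $x(0)=\xi$ and $\dot x(t)\in G(x(t))$ for almost all $t\in\mathbb{R}$. A Filippov solution $x$ for the initial state $\xi$ is right-unique if for any Filippov solution $x'$ for the initial state $\xi$ there exists $\epsilon>0$ such that $x(t)=x'(t)$ for all $t\in[0,\epsilon)$. For a vector $v$, $v\succ0$ means $v$ is nonzero and its first nonzero entry is positive; $v\succ w$ means $v-w\succ0$. *)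

theory Defs
  imports "HOL-Analysis.Analysis"
begin

(* absolutely_continuous of HOL-Analysis is a relation between measures; the notion for
   functions is defined here. *)
definition abs_continuous_on_interval ::
    "(real \<Rightarrow> 'a::real_normed_vector) \<Rightarrow> real \<Rightarrow> real \<Rightarrow> bool" where
  "abs_continuous_on_interval x a b \<longleftrightarrow>
     (\<forall>\<epsilon>>0. \<exists>\<delta>>0. \<forall>I :: (real \<times> real) set.
        finite I \<and>
        (\<forall>(s, t)\<in>I. a \<le> s \<and> s < t \<and> t \<le> b) \<and>
        disjoint_family_on (\<lambda>(s, t). {s<..<t}) I \<and>
        (\<Sum>(s, t)\<in>I. t - s) < \<delta>
        \<longrightarrow> (\<Sum>(s, t)\<in>I. norm (x t - x s)) < \<epsilon>)"

definition pwa_map ::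
    "real^'n^'n \<Rightarrow> real^'n^'n \<Rightarrow> real^'n \<Rightarrow> real^'n \<Rightarrow> real^'n \<Rightarrow> real \<Rightarrow> real^'n \<Rightarrow> (real^'n) set" where
  "pwa_map A1 A2 e1 e2 c f x =
     (if c \<bullet> x + f < 0 then {A1 *v x + e1}
      else if c \<bullet> x + f = 0 then convex hull {A1 *v x + e1, A2 *v x + e2}
      else {A2 *v x + e2})"

definition filippov_solution ::
    "(real^'n \<Rightarrow> (real^'n) set) \<Rightarrow> real^'n \<Rightarrow> (real \<Rightarrow> real^'n) \<Rightarrow> bool" where
  "filippov_solution G \<xi> x \<longleftrightarrow>
     (\<forall>a b. a \<le> b \<longrightarrow> abs_continuous_on_interval x a b) \<and>
     x 0 = \<xi> \<and>
     (AE t in lebesgue. \<exists>v\<in>G (x t). (x has_vector_derivative v) (at t))"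

definition right_unique_solution ::
    "(real^'n \<Rightarrow> (real^'n) set) \<Rightarrow> real^'n \<Rightarrow> (real \<Rightarrow> real^'n) \<Rightarrow> bool" where
  "right_unique_solution G \<xi> x \<longleftrightarrow>
     filippov_solution G \<xi> x \<and>
     (\<forall>x'. filippov_solution G \<xi> x' \<longrightarrow> (\<exists>\<epsilon>>0. \<forall>t\<in>{0..<\<epsilon>}. x t = x' t))"

(* The first nonzero entry of a nonzero v is v$1 if v$1 is nonzero, and v$2 otherwise. The index
   order of the type 2 cannot be used to say "first", because 2 = 0 < 1 there. *)
definition lex_pos :: "real^2 \<Rightarrow> bool" where
  "lex_pos v \<longleftrightarrow> v \<noteq> 0 \<and> v $ (if v $ 1 \<noteq> 0 then 1 else 2) > 0"

definition lex_greater :: "real^2 \<Rightarrow> real^2 \<Rightarrow> bool" where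
  "lex_greater v w \<longleftrightarrow> lex_pos (v - w)"

definition lower_triangular2 :: "real^2^2 \<Rightarrow> bool" where
  "lower_triangular2 M \<longleftrightarrow> M $ 1 $ 2 = 0"

end

theory Submission
  imports Defs
begin

text \<open>
  Write \<open>y = c \<bullet> x + f\<close> and let \<open>g1\<close>, \<open>g2\<close> be the normal velocities \<open>c \<bullet> (A1 x + e1)\<close>,
  \<open>c \<bullet> (A2 x + e2)\<close> of the two modes. On the switching plane the hypothesis gives
  \<open>g1 > m * g2\<close> with \<open>m > 0\<close>, so \<open>g1 > 0\<close> or \<open>g2 < 0\<close>; exchanging the modes, we may
  assume \<open>g1 > 0\<close> at a point of the plane. Then solutions stay in \<open>y \<ge> 0\<close> for a short time.
  A differentiable \<open>y \<ge> 0\<close> has zero derivative wherever it vanishes, so either the plane is crossed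
  at once, or the velocity is \<open>A2 x + e2 + \<lambda> h x\<close> with \<open>h\<close> the difference of the two modes,
  \<open>c \<bullet> h > 0\<close>, and \<open>\<lambda> \<noteq> 0\<close> only where \<open>y = 0\<close>. For two such solutions with difference \<open>d\<close>, the function
  \<open>|(c \<bullet> h) d - (c \<bullet> d) h|\<^sup>2 + (c \<bullet> d)\<^sup>2\<close> obeys a Gronwall inequality: the first vector projects out the
  direction \<open>h\<close> in which \<open>\<lambda>\<close> acts, and in the second term \<open>\<lambda>\<close> can only contribute negatively.
\<close>

subsection \<open>Absolutely continuous and Lipschitz functions\<close>

text \<open>This is the mean value inequality with an exceptional null set. Off that set the
  derivative controls short increments; on it, absolute continuity makes their total small. The
  bound on the derivative is one-sided, as sign and Gronwall arguments require.\<close>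

lemma abs_continuous_increment_le:
  fixes g :: "real \<Rightarrow> real"
  assumes ac: "abs_continuous_on_interval g a b" and ab: "a \<le> b" and B: "0 \<le> B"
    and der: "AE t in lebesgue. t \<in> {a<..<b} \<longrightarrow> (\<exists>D\<le>B. (g has_real_derivative D) (at t))"
  shows "g b - g a \<le> B * (b - a)"
proof -
  obtain N0 where N0: "\<And>t. t \<in> space lebesgue - N0 \<Longrightarrow> t \<in> {a<..<b} \<longrightarrow> (\<exists>D\<le>B. (g has_real_derivative D) (at t))"
    and N0n: "N0 \<in> null_sets lebesgue"
    using AE_E3[OF der] by blast
  \<comment> \<open>The derivative is only known inside the interval, so both endpoints join the
    exceptional set.\<close>
  define N where "N = N0 \<union> {a, b}"
  have Nn: "N \<in> null_sets lebesgue"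
  proof -
    have "negligible N0" using N0n by (simp only: negligible_iff_null_sets)
    then have "negligible (N0 \<union> {a, b})"
      by (rule negligible_Un) (simp add: negligible_finite)
    then show ?thesis by (simp only: N_def negligible_iff_null_sets)
  qed
  \<comment> \<open>The two errors have different sources: \<open>e * (b - a)\<close> comes from
    linear approximation at points of differentiability, the last \<open>e\<close> from absolute
    continuity on the exceptional intervals.\<close>
  have main: "g b - g a \<le> B * (b - a) + e * (b - a) + e" if e: "e > 0" for e
  proof -
    obtain \<delta> where \<delta>: "\<delta> > 0" and ac': "\<And>I :: (real \<times> real) set.
        finite I \<Longrightarrow> \<forall>(s, t)\<in>I. a \<le> s \<and> s < t \<and> t \<le> b \<Longrightarrow>
        disjoint_family_on (\<lambda>(s, t). {s<..<t}) I \<Longrightarrow>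
        (\<Sum>(s, t)\<in>I. t - s) < \<delta> \<Longrightarrow> (\<Sum>(s, t)\<in>I. norm (g t - g s)) < e"
      using ac[unfolded abs_continuous_on_interval_def, THEN spec, THEN mp, OF e] by auto
    obtain U where U: "open U" "N \<subseteq> U" "emeasure lebesgue (U - N) < ennreal \<delta>"
      using sets_lebesgue_outer_open[OF null_setsD2[OF Nn] \<delta>] by blast
    have Us: "U \<in> sets lebesgue" using U(1) by (simp add: borel_open)
    have emU: "emeasure lebesgue U < ennreal \<delta>"
      using U(3) emeasure_Diff_null_set[OF Nn Us] by simp
    have Ulm: "U \<in> lmeasurable"
      using order.strict_trans[OF emU ennreal_less_top] Us by (intro fmeasurableI) (simp_all add: less_top)
    have Um: "measure lebesgue U < \<delta>"
      using emU \<delta> unfolding emeasure_eq_measure2[OF Ulm] by (simp only: ennreal_less_iff measure_nonneg)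
    \<comment> \<open>Cousin's lemma: intervals tagged outside \<open>N\<close> are controlled by the derivative,
      those tagged in \<open>N\<close> have total length below \<open>\<delta>\<close> and are controlled by absolute continuity.\<close>
    have "\<exists>\<eta>>0. t \<in> {a..b} - N \<longrightarrow> (\<forall>u v. u \<le> t \<and> t \<le> v \<and> dist t u < \<eta> \<and> dist t v < \<eta> \<longrightarrow>
            g v - g u \<le> (B + e) * (v - u))" for t
    proof (cases "t \<in> {a..b} - N")
      case True
      then have "t \<in> {a<..<b}" "t \<notin> N0" unfolding N_def by auto
      then obtain D where D: "D \<le> B" "(g has_real_derivative D) (at t)"
        using N0[of t] by auto
      then obtain \<eta> where \<eta>: "\<eta> > 0"
        and lin: "\<And>s. norm (s - t) < \<eta> \<Longrightarrow> norm (g s - g t - D * (s - t)) \<le> e * norm (s - t)"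
        using e unfolding has_field_derivative_def has_derivative_at_alt by metis
      \<comment> \<open>Since \<open>t\<close> lies between \<open>u\<close> and \<open>v\<close>,
        the errors \<open>e * (v - t)\<close> and \<open>e * (t - u)\<close> add up to
        \<open>e * (v - u)\<close>.\<close>
      have "g v - g u \<le> (B + e) * (v - u)" if uv: "u \<le> t" "t \<le> v" "dist t u < \<eta>" "dist t v < \<eta>" for u v
      proof -
        have "g v - g t - D * (v - t) \<le> e * (v - t)"
          using lin[of v] uv by (auto simp: dist_real_def)
        moreover have "- (g u - g t - D * (u - t)) \<le> e * (t - u)"
          using lin[of u] uv by (auto simp: dist_real_def)
        moreover have "D * (v - u) \<le> B * (v - u)" using D(1) uv by (intro mult_right_mono) auto
        ultimately show ?thesis by (simp add: algebra_simps)
      qed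
      with \<eta> show ?thesis by blast
    next
      case False
      then show ?thesis by (intro exI[of _ 1]) auto
    qed
    then obtain \<eta> where \<eta>0: "\<And>t. \<eta> t > 0" and \<eta>: "\<And>t u v. \<lbrakk>t \<in> {a..b} - N; u \<le> t; t \<le> v; dist t u < \<eta> t; dist t v < \<eta> t\<rbrakk> \<Longrightarrow>
            g v - g u \<le> (B + e) * (v - u)" by metis
    \<comment> \<open>Fineness puts an interval tagged in \<open>N\<close> inside \<open>U\<close>,
      and any other one inside the ball on which the derivative estimate holds.\<close>
    define \<gamma> where "\<gamma> t = (if t \<in> N then U else ball t (\<eta> t))" for t
    have "gauge \<gamma>"
      unfolding gauge_def \<gamma>_def using U \<eta>0 by auto
    then obtain p where p: "p tagged_division_of {a..b}" "\<gamma> fine p"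
      using fine_division_exists_real by blast
    note pD = tagged_division_ofD[OF p(1)]
    have iv: "\<exists>u v. K = {u..v} \<and> u \<le> x \<and> x \<le> v \<and> a \<le> u \<and> v \<le> b \<and> Inf K = u \<and> Sup K = v" if xK: "(x, K) \<in> p" for x K
    proof -
      obtain u v where uv: "K = {u..v}" using pD(4)[OF xK] by auto
      with pD(2,3)[OF xK] show ?thesis by (auto intro!: exI[of _ u] exI[of _ v])
    qed
    \<comment> \<open>Degenerate intervals are left out of \<open>q\<close>: they contribute no
      increment, and absolute continuity speaks of intervals with \<open>s < t\<close>.\<close>
    define q where "q = {(x, K) \<in> p. x \<in> N \<and> Inf K < Sup K}"
    define r where "r = (\<lambda>(x :: real, K). (Inf K :: real, Sup K))"
    have qp: "q \<subseteq> p" and fq: "finite q" using pD(1) by (auto simp: q_def intro: finite_subset)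
    have disj: "{Inf K<..<Sup K} \<inter> {Inf K'<..<Sup K'} = {}"
      if q: "(x, K) \<in> q" "(x', K') \<in> q" "(x, K) \<noteq> (x', K')" for x K x' K'
    proof -
      obtain u v where 1: "K = {u..v}" "Inf K = u" "Sup K = v" using iv q(1) qp by blast
      obtain u' v' where 2: "K' = {u'..v'}" "Inf K' = u'" "Sup K' = v'" using iv q(2) qp by blast
      show ?thesis using pD(5)[of x K x' K'] q qp 1 2 by auto
    qed
    have ne: "{Inf K<..<Sup K} \<noteq> {}" if "(x, K) \<in> q" for x K
      using that by (simp add: q_def)
    \<comment> \<open>\<open>r\<close> forgets the tags. Two different members of \<open>q\<close>
      with the same endpoints would have equal, nonempty and yet disjoint interiors.\<close>
    have inj: "inj_on r q"
    proof (rule inj_onI)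
      fix i j assume q: "i \<in> q" "j \<in> q" and eq: "r i = r j"
      obtain x K x' K' where ij: "i = (x, K)" "j = (x', K')" by (cases i, cases j)
      show "i = j"
      proof (rule ccontr)
        assume "i \<noteq> j"
        then have "{Inf K<..<Sup K} = {}"
          using disj[of x K x' K'] q ij eq by (auto simp: r_def)
        then show False using ne q ij by blast
      qed
    qed
    have dI: "disjoint_family_on (\<lambda>(s, t). {s<..<t}) (r ` q)"
      unfolding disjoint_family_on_def
    proof (intro ballI impI)
      fix m n assume "m \<in> r ` q" "n \<in> r ` q" "m \<noteq> n"
      then obtain x K x' K' where "(x, K) \<in> q" "(x', K') \<in> q" "m = r (x, K)" "n = r (x', K')"
        by fastforce
      with \<open>m \<noteq> n\<close> disj[of x K x' K']
      show "(case m of (s, t) \<Rightarrow> {s<..<t}) \<inter> (case n of (s, t) \<Rightarrow> {s<..<t}) = {}"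
        by (auto simp: r_def)
    qed
    have inU: "{Inf K..Sup K} \<subseteq> U" if "(x, K) \<in> q" for x K
    proof -
      have "(x, K) \<in> p" "x \<in> N" using that by (auto simp: q_def)
      moreover have "K \<subseteq> \<gamma> x" using p(2) \<open>(x, K) \<in> p\<close> by (auto simp: fine_def)
      ultimately show ?thesis using iv[of x K] by (auto simp: \<gamma>_def)
    qed
    have "(\<Sum>(s, t)\<in>r ` q. t - s) = (\<Sum>i\<in>r ` q. measure lebesgue ((\<lambda>(s, t). {s<..<t}) i))"
      by (rule sum.cong) (auto simp: r_def q_def)
    also have "\<dots> = measure lebesgue (\<Union>i\<in>r ` q. (\<lambda>(s, t). {s<..<t}) i)"
      using dI fq by (intro measure_finite_Union[symmetric]) (auto simp: r_def q_def)
    also have "\<dots> \<le> measure lebesgue U"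
    proof (rule measure_mono_fmeasurable[OF _ _ Ulm])
      show "(\<Union>i\<in>r ` q. (\<lambda>(s, t). {s<..<t}) i) \<subseteq> U" using inU by (fastforce simp: r_def)
      show "(\<Union>i\<in>r ` q. (\<lambda>(s, t). {s<..<t}) i) \<in> sets lebesgue"
        using fq by (intro sets.finite_UN) auto
    qed
    also have "\<dots> < \<delta>" by (rule Um)
    finally have small: "(\<Sum>(s, t)\<in>r ` q. t - s) < \<delta>" .
    have "\<forall>(s, t)\<in>r ` q. a \<le> s \<and> s < t \<and> t \<le> b"
      using iv qp by (fastforce simp: r_def q_def)
    then have "(\<Sum>(s, t)\<in>r ` q. norm (g t - g s)) < e"
      using ac' fq dI small by blast
    then have qsum: "(\<Sum>(x, K)\<in>q. norm (g (Sup K) - g (Inf K))) < e"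
      using inj by (simp add: sum.reindex r_def case_prod_unfold o_def)
    have "g b - g a = (\<Sum>(x, K)\<in>p. g (Sup K) - g (Inf K))"
      by (rule additive_tagged_division_1[OF ab p(1), symmetric])
    also have "\<dots> = (\<Sum>(x, K)\<in>p - q. g (Sup K) - g (Inf K)) + (\<Sum>(x, K)\<in>q. g (Sup K) - g (Inf K))"
      using sum.subset_diff[OF qp pD(1)] by simp
    also have "\<dots> \<le> (\<Sum>(x, K)\<in>p - q. (B + e) * (Sup K - Inf K)) + (\<Sum>(x, K)\<in>q. norm (g (Sup K) - g (Inf K)))"
    proof (intro add_mono sum_mono)
      fix i assume i: "i \<in> p - q"
      obtain x K where xK: "i = (x, K)" "(x, K) \<in> p" "(x, K) \<notin> q" using i by (cases i) auto
      obtain u v where uv: "K = {u..v}" "u \<le> x" "x \<le> v" "a \<le> u" "v \<le> b" "Inf K = u" "Sup K = v"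
        using iv[OF xK(2)] by blast
      have "g v - g u \<le> (B + e) * (v - u)"
      \<comment> \<open>Outside \<open>q\<close> an interval is either degenerate or tagged off
        \<open>N\<close>; only the second kind calls for the derivative.\<close>
      proof (cases "u = v")
        case False
        then have "x \<notin> N" using xK uv by (auto simp: q_def)
        moreover have "K \<subseteq> \<gamma> x" using p(2) xK(2) by (auto simp: fine_def)
        ultimately have "K \<subseteq> ball x (\<eta> x)" by (simp add: \<gamma>_def)
        moreover have "u \<in> K" "v \<in> K" using uv by auto
        ultimately have "dist x u < \<eta> x" "dist x v < \<eta> x" by (auto simp only: subset_iff mem_ball)
        then show ?thesis using \<eta>[of x u v] uv \<open>x \<notin> N\<close> by auto
      qed auto
      then show "(case i of (x, K) \<Rightarrow> g (Sup K) - g (Inf K)) \<le> (case i of (x, K) \<Rightarrow> (B + e) * (Sup K - Inf K))"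
        using uv xK by simp
    qed auto
    \<comment> \<open>The intervals of \<open>q\<close> can be put back into the first sum because
      \<open>B + e\<close> is nonnegative; then the lengths telescope.\<close>
    also have "\<dots> \<le> (\<Sum>(x, K)\<in>p. (B + e) * (Sup K - Inf K)) + e"
    proof (intro add_mono sum_mono2)
      show "(\<Sum>(x, K)\<in>q. norm (g (Sup K) - g (Inf K))) \<le> e" using qsum by simp
      fix i assume "i \<in> p - (p - q)"
      then obtain x K where "i = (x, K)" "(x, K) \<in> p" by (cases i) auto
      then show "0 \<le> (case i of (x, K) \<Rightarrow> (B + e) * (Sup K - Inf K))"
        using iv[of x K] B e by auto
    qed (use pD(1) in auto)
    also have "(\<Sum>(x, K)\<in>p. (B + e) * (Sup K - Inf K)) = (B + e) * (b - a)"
      using additive_tagged_division_1[OF ab p(1), of "\<lambda>x. x"]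
      by (simp add: sum_distrib_left[symmetric] case_prod_unfold)
    finally show ?thesis by (simp add: algebra_simps)
  qed
  show ?thesis
  proof (rule field_le_epsilon)
    fix e :: real assume e: "e > 0"
    \<comment> \<open>Dividing by \<open>b - a + 1\<close> makes the two errors add up to exactly
      \<open>e\<close>, also when \<open>a = b\<close>.\<close>
    have "g b - g a \<le> B * (b - a) + e / (b - a + 1) * (b - a) + e / (b - a + 1)"
      using main[of "e / (b - a + 1)"] e ab by simp
    also have "\<dots> = B * (b - a) + e / (b - a + 1) * (b - a + 1)"
      by (simp only: distrib_left mult_1_right add.assoc)
    also have "\<dots> = B * (b - a) + e" using ab by simp
    finally show "g b - g a \<le> B * (b - a) + e" .
  qed
qed

text \<open>One comparison of increments serves both for linear functionals of a solution and,
  taking the identity for \<open>x\<close>, for Lipschitz functions.\<close>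

lemma abs_continuous_dominated:
  assumes ac: "abs_continuous_on_interval x a b"
    and dom: "\<And>s t. \<lbrakk>a \<le> s; s < t; t \<le> b\<rbrakk> \<Longrightarrow> norm (g t - g s) \<le> C * norm (x t - x s)"
  shows "abs_continuous_on_interval g a b"
  unfolding abs_continuous_on_interval_def
proof (intro allI impI)
  fix \<epsilon> :: real assume "\<epsilon> > 0"
  then have e: "\<epsilon> / (\<bar>C\<bar> + 1) > 0" by simp
  obtain \<delta> where \<delta>: "\<delta> > 0" and ac': "\<And>I :: (real \<times> real) set.
      finite I \<and> (\<forall>(s, t)\<in>I. a \<le> s \<and> s < t \<and> t \<le> b) \<and>
      disjoint_family_on (\<lambda>(s, t). {s<..<t}) I \<and>
      (\<Sum>(s, t)\<in>I. t - s) < \<delta> \<Longrightarrow> (\<Sum>(s, t)\<in>I. norm (x t - x s)) < \<epsilon> / (\<bar>C\<bar> + 1)"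
    using ac[unfolded abs_continuous_on_interval_def, THEN spec, THEN mp, OF e] by auto
  show "\<exists>\<delta>>0. \<forall>I :: (real \<times> real) set.
      finite I \<and> (\<forall>(s, t)\<in>I. a \<le> s \<and> s < t \<and> t \<le> b) \<and>
      disjoint_family_on (\<lambda>(s, t). {s<..<t}) I \<and>
      (\<Sum>(s, t)\<in>I. t - s) < \<delta> \<longrightarrow> (\<Sum>(s, t)\<in>I. norm (g t - g s)) < \<epsilon>"
  proof (intro exI[of _ \<delta>] conjI allI impI \<delta>)
    fix I :: "(real \<times> real) set"
    assume I: "finite I \<and> (\<forall>(s, t)\<in>I. a \<le> s \<and> s < t \<and> t \<le> b) \<and>
      disjoint_family_on (\<lambda>(s, t). {s<..<t}) I \<and> (\<Sum>(s, t)\<in>I. t - s) < \<delta>"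
    have "(\<Sum>(s, t)\<in>I. norm (g t - g s)) \<le> (\<Sum>(s, t)\<in>I. (\<bar>C\<bar> + 1) * norm (x t - x s))"
    proof (rule sum_mono, clarify)
      fix s t assume "(s, t) \<in> I"
      then have "norm (g t - g s) \<le> C * norm (x t - x s)" using I dom by auto
      also have "\<dots> \<le> (\<bar>C\<bar> + 1) * norm (x t - x s)" by (intro mult_right_mono) auto
      finally show "norm (g t - g s) \<le> (\<bar>C\<bar> + 1) * norm (x t - x s)" .
    qed
    also have "\<dots> = (\<bar>C\<bar> + 1) * (\<Sum>(s, t)\<in>I. norm (x t - x s))"
      by (simp add: sum_distrib_left case_prod_unfold)
    also have "\<dots> < (\<bar>C\<bar> + 1) * (\<epsilon> / (\<bar>C\<bar> + 1))"
      using ac'[OF I] by (intro mult_strict_left_mono) auto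
    finally show "(\<Sum>(s, t)\<in>I. norm (g t - g s)) < \<epsilon>" by simp
  qed
qed

lemma abs_continuous_subset:
  assumes "abs_continuous_on_interval x a b" "a \<le> a'" "b' \<le> b"
  shows "abs_continuous_on_interval x a' b'"
  unfolding abs_continuous_on_interval_def
proof (intro allI impI)
  fix \<epsilon> :: real assume e: "\<epsilon> > 0"
  obtain \<delta> where \<delta>: "\<delta> > 0" and ac': "\<And>I :: (real \<times> real) set.
      \<lbrakk>finite I; \<forall>(s, t)\<in>I. a \<le> s \<and> s < t \<and> t \<le> b;
      disjoint_family_on (\<lambda>(s, t). {s<..<t}) I;
      (\<Sum>(s, t)\<in>I. t - s) < \<delta>\<rbrakk> \<Longrightarrow> (\<Sum>(s, t)\<in>I. norm (x t - x s)) < \<epsilon>"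
    using assms(1)[unfolded abs_continuous_on_interval_def, THEN spec, THEN mp, OF e] by auto
  show "\<exists>\<delta>>0. \<forall>I :: (real \<times> real) set.
      finite I \<and> (\<forall>(s, t)\<in>I. a' \<le> s \<and> s < t \<and> t \<le> b') \<and>
      disjoint_family_on (\<lambda>(s, t). {s<..<t}) I \<and>
      (\<Sum>(s, t)\<in>I. t - s) < \<delta> \<longrightarrow> (\<Sum>(s, t)\<in>I. norm (x t - x s)) < \<epsilon>"
    using assms(2,3) by (intro exI[of _ \<delta>] conjI allI impI \<delta> ac') fastforce+
qed

lemma abs_continuous_id: "abs_continuous_on_interval (\<lambda>t. t) a b"
  unfolding abs_continuous_on_interval_def
proof (intro allI impI)
  fix \<epsilon> :: real assume e: "\<epsilon> > 0"
  show "\<exists>\<delta>>0. \<forall>I :: (real \<times> real) set.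
      finite I \<and> (\<forall>(s, t)\<in>I. a \<le> s \<and> s < t \<and> t \<le> b) \<and>
      disjoint_family_on (\<lambda>(s, t). {s<..<t}) I \<and>
      (\<Sum>(s, t)\<in>I. t - s) < \<delta> \<longrightarrow> (\<Sum>(s, t)\<in>I. norm (t - s)) < \<epsilon>"
  proof (intro exI[of _ \<epsilon>] conjI allI impI e)
    fix I :: "(real \<times> real) set"
    assume I: "finite I \<and> (\<forall>(s, t)\<in>I. a \<le> s \<and> s < t \<and> t \<le> b) \<and>
      disjoint_family_on (\<lambda>(s, t). {s<..<t}) I \<and> (\<Sum>(s, t)\<in>I. t - s) < \<epsilon>"
    then have "(\<Sum>(s, t)\<in>I. norm (t - s)) = (\<Sum>(s, t)\<in>I. t - s)"
      by (intro sum.cong) auto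
    then show "(\<Sum>(s, t)\<in>I. norm (t - s)) < \<epsilon>" using I by simp
  qed
qed

lemma lipschitz_on_imp_abs_continuous:
  assumes "L-lipschitz_on {a..b} g"
  shows "abs_continuous_on_interval g a b"
proof (rule abs_continuous_dominated[OF abs_continuous_id, of _ _ _ L])
  fix s t assume "a \<le> s" "s < t" "t \<le> b"
  then show "norm (g t - g s) \<le> L * norm (t - s)"
    by (intro lipschitz_on_normD[OF assms]) auto
qed

lemma abs_continuous_imp_continuous_on:
  assumes "abs_continuous_on_interval x a b"
  shows "continuous_on {a..b} x"
  unfolding continuous_on_iff
proof (intro ballI allI impI)
  fix t and e :: real assume t: "t \<in> {a..b}" and e: "e > 0"
  obtain \<delta> where \<delta>: "\<delta> > 0" and ac: "\<And>I :: (real \<times> real) set.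
      \<lbrakk>finite I; \<forall>(s, t)\<in>I. a \<le> s \<and> s < t \<and> t \<le> b;
      disjoint_family_on (\<lambda>(s, t). {s<..<t}) I;
      (\<Sum>(s, t)\<in>I. t - s) < \<delta>\<rbrakk> \<Longrightarrow> (\<Sum>(s, t)\<in>I. norm (x t - x s)) < e"
    using assms[unfolded abs_continuous_on_interval_def, THEN spec, THEN mp, OF e] by auto
  have *: "norm (x v - x u) < e" if "u \<in> {a..b}" "v \<in> {a..b}" "u < v" "v - u < \<delta>" for u v
    using ac[of "{(u, v)}"] that by (auto simp: disjoint_family_on_def)
  show "\<exists>d>0. \<forall>s\<in>{a..b}. dist s t < d \<longrightarrow> dist (x s) (x t) < e"
  proof (intro exI[of _ \<delta>] conjI \<delta> ballI impI)
    fix s assume "s \<in> {a..b}" "dist s t < \<delta>"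
    then show "dist (x s) (x t) < e"
      using *[of s t] *[of t s] t e
      by (cases s t rule: linorder_cases) (auto simp: dist_real_def dist_norm norm_minus_commute)
  qed
qed

section \<open>Lipschitz functions: products and velocity bounds\<close>

lemma lipschitz_on_bounded_image:
  fixes g :: "'a::metric_space \<Rightarrow> 'b::metric_space"
  assumes "L-lipschitz_on U g" "bounded U"
  shows "bounded (g ` U)"
proof (cases "U = {}")
  case False
  then obtain u where u: "u \<in> U" by blast
  obtain r where r: "\<And>t. t \<in> U \<Longrightarrow> dist u t \<le> r"
    using assms(2) bounded_any_center[of U u] by auto
  have "dist (g u) (g t) \<le> L * r" if "t \<in> U" for t
    using lipschitz_onD[OF assms(1) u that] mult_left_mono[OF r[OF that] lipschitz_on_nonneg[OF assms(1)]]
    by linarith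
  then show ?thesis unfolding bounded_def by blast
qed auto

text \<open>The difference splits as in the product rule, and boundedness of \<open>U\<close> bounds
  the values that appear as factors. Inner products, scalar multiples and real products are all
  instances; this is how the Lyapunov function below becomes Lipschitz.\<close>

lemma lipschitz_on_bilinear:
  fixes f :: "'d::real_normed_vector \<Rightarrow> 'a::real_normed_vector"
    and g :: "'d \<Rightarrow> 'b::real_normed_vector" and P :: "'a \<Rightarrow> 'b \<Rightarrow> 'c::real_normed_vector"
  assumes P: "bounded_bilinear P" and U: "bounded U"
    and f: "\<exists>L. L-lipschitz_on U f" and g: "\<exists>L. L-lipschitz_on U g"
  shows "\<exists>L. L-lipschitz_on U (\<lambda>t. P (f t) (g t))"
proof -
  interpret bounded_bilinear P by (rule P)
  obtain K where K: "K \<ge> 0" "\<And>a b. norm (P a b) \<le> norm a * norm b * K"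
    using nonneg_bounded by blast
  obtain F G where F: "F-lipschitz_on U f" and G: "G-lipschitz_on U g" using f g by blast
  have "bounded (f ` U)" "bounded (g ` U)"
    using lipschitz_on_bounded_image[OF F U] lipschitz_on_bounded_image[OF G U] .
  then obtain bf bg where b: "bf > 0" "bg > 0" "\<And>t. t \<in> U \<Longrightarrow> norm (f t) \<le> bf" "\<And>t. t \<in> U \<Longrightarrow> norm (g t) \<le> bg"
    unfolding bounded_pos by auto
  have F0: "F \<ge> 0" and G0: "G \<ge> 0" using F G lipschitz_on_nonneg by blast+
  have "(bf * G * K + F * bg * K)-lipschitz_on U (\<lambda>t. P (f t) (g t))"
  proof (rule lipschitz_onI)
    show "0 \<le> bf * G * K + F * bg * K" using b F0 G0 K by simp
    fix s t assume st: "s \<in> U" "t \<in> U"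
    have "P (f s) (g s) - P (f t) (g t) = P (f s) (g s - g t) + P (f s - f t) (g t)"
      by (simp add: diff_left diff_right)
    also have "norm \<dots> \<le> norm (f s) * norm (g s - g t) * K + norm (f s - f t) * norm (g t) * K"
      by (intro order.trans[OF norm_triangle_ineq] add_mono K)
    also have "\<dots> \<le> bf * (G * norm (s - t)) * K + (F * norm (s - t)) * bg * K"
      using st b F0 G0 K(1) lipschitz_on_normD[OF F] lipschitz_on_normD[OF G]
      by (intro add_mono mult_mono mult_right_mono) auto
    finally show "dist (P (f s) (g s)) (P (f t) (g t)) \<le> (bf * G * K + F * bg * K) * dist s t"
      by (simp add: dist_norm algebra_simps)
  qed
  then show ?thesis by blast
qed

text \<open>Pairing with the direction of the total increment reduces the vector case to the real
  one, and this pairing loses none of that increment.\<close>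

lemma abs_continuous_norm_increment_le:
  fixes x :: "real \<Rightarrow> 'a::real_inner"
  assumes ac: "abs_continuous_on_interval x a b" and ab: "a \<le> b" and B: "0 \<le> B"
    and der: "AE t in lebesgue. t \<in> {a<..<b} \<longrightarrow> (\<exists>v. (x has_vector_derivative v) (at t) \<and> norm v \<le> B)"
  shows "norm (x b - x a) \<le> B * (b - a)"
proof -
  \<comment> \<open>\<open>sgn\<close> gives the unit direction, and 0 when the increment vanishes,
    so in general only \<open>norm u \<le> 1\<close> holds.\<close>
  define u where "u = sgn (x b - x a)"
  have u1: "norm u \<le> 1" by (simp add: u_def norm_sgn)
  have le: "\<bar>u \<bullet> v\<bar> \<le> norm v" for v
    using Cauchy_Schwarz_ineq2[of u v] mult_right_mono[OF u1 norm_ge_zero[of v]] by simp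
  have "u \<bullet> x b - u \<bullet> x a \<le> B * (b - a)"
  proof (rule abs_continuous_increment_le[OF _ ab B])
    show "abs_continuous_on_interval (\<lambda>t. u \<bullet> x t) a b"
      using le by (intro abs_continuous_dominated[OF ac, of _ 1]) (simp add: inner_diff_right[symmetric])
    show "AE t in lebesgue. t \<in> {a<..<b} \<longrightarrow> (\<exists>D\<le>B. ((\<lambda>t. u \<bullet> x t) has_real_derivative D) (at t))"
      using der
    proof eventually_elim
      case (elim t)
      show ?case
      proof
        assume "t \<in> {a<..<b}"
        then obtain v where v: "(x has_vector_derivative v) (at t)" "norm v \<le> B" using elim by blast
        have "((\<lambda>t. u \<bullet> x t) has_vector_derivative u \<bullet> v) (at t)"
          by (rule bounded_linear.has_vector_derivative[OF bounded_linear_inner_right v(1)])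
        then show "\<exists>D\<le>B. ((\<lambda>t. u \<bullet> x t) has_real_derivative D) (at t)"
          using le[of v] v(2) by (intro exI[of _ "u \<bullet> v"]) (auto simp: has_real_derivative_iff_has_vector_derivative)
      qed
    qed
  qed
  moreover have "u \<bullet> (x b - x a) = norm (x b - x a)"
    by (cases "x b = x a") (simp_all add: u_def sgn_div_norm dot_square_norm power2_eq_square)
  ultimately show ?thesis by (simp add: inner_diff_right)
qed

text \<open>The increment bound applies on every subinterval. Solutions confined to a ball have
  bounded velocity, so they become Lipschitz and can be multiplied freely.\<close>

lemma abs_continuous_bounded_deriv_imp_lipschitz:
  fixes x :: "real \<Rightarrow> 'a::real_inner"
  assumes ac: "abs_continuous_on_interval x a b" and B: "0 \<le> B"
    and der: "AE t in lebesgue. t \<in> {a<..<b} \<longrightarrow> (\<exists>v. (x has_vector_derivative v) (at t) \<and> norm v \<le> B)"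
  shows "B-lipschitz_on {a..b} x"
proof -
  have *: "norm (x t - x s) \<le> B * (t - s)" if st: "a \<le> s" "s \<le> t" "t \<le> b" for s t
  proof (rule abs_continuous_norm_increment_le[OF abs_continuous_subset[OF ac st(1,3)] st(2) B])
    show "AE \<tau> in lebesgue. \<tau> \<in> {s<..<t} \<longrightarrow> (\<exists>v. (x has_vector_derivative v) (at \<tau>) \<and> norm v \<le> B)"
      using der by eventually_elim (use st in auto)
  qed
  show ?thesis
  proof (rule lipschitz_onI[OF _ B])
    fix s t assume "s \<in> {a..b}" "t \<in> {a..b}"
    then show "dist (x s) (x t) \<le> B * dist s t"
      using *[of s t] *[of t s] by (cases "s \<le> t") (auto simp: dist_norm norm_minus_commute)
  qed
qed

subsection \<open>Flows with one-sided reflection\<close>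

text \<open>This is the differential inequality for the Lyapunov function, stated at single points:
  \<open>w'\<close> is the derivative of \<open>w\<close> when \<open>x\<close> and \<open>z\<close>
  move with velocities \<open>x'\<close> and \<open>z'\<close>. In the terms with
  \<open>x' - z'\<close> the multiplier \<open>m\<close> cancels, and \<open>\<rho>\<close> survives
  only with a factor \<open>H (x - z)\<close>. Hence \<open>w'\<close> is bounded by a multiple of
  \<open>x - z\<close>, which transversality bounds in terms of \<open>w\<close> and
  \<open>c \<bullet> (x - z)\<close>.\<close>

lemma lyapunov_bound:
  fixes A H :: "'a::real_inner \<Rightarrow> 'a" and c e g :: 'a
  assumes A: "bounded_linear A" and H: "bounded_linear H" and \<delta>: "\<delta> > 0" and R: "R \<ge> 0"
  obtains C where "C \<ge> 0"
    "\<And>x z m \<rho> x' z' w w'. \<lbrakk>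
      norm x \<le> R; norm z \<le> R; 0 \<le> m; m \<le> 1; 0 \<le> \<rho>; \<rho> \<le> 1;
      m = 0 \<or> c \<bullet> (x - z) \<le> 0; \<rho> = 0 \<or> c \<bullet> (x - z) \<ge> 0;
      \<delta> \<le> c \<bullet> (H x + g); \<delta> \<le> c \<bullet> (H z + g);
      x' = A x + e + m *\<^sub>R (H x + g); z' = A z + e + \<rho> *\<^sub>R (H z + g);
      w = (c \<bullet> (H x + g)) *\<^sub>R (x - z) - (c \<bullet> (x - z)) *\<^sub>R (H x + g);
      w' = (c \<bullet> H x') *\<^sub>R (x - z) + (c \<bullet> (H x + g)) *\<^sub>R (x' - z')
           - (c \<bullet> (x' - z')) *\<^sub>R (H x + g) - (c \<bullet> (x - z)) *\<^sub>R H x'\<rbrakk> \<Longrightarrow>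
      2 * (w \<bullet> w') + 2 * ((c \<bullet> (x - z)) * (c \<bullet> (x' - z')))
        \<le> C * (w \<bullet> w + (c \<bullet> (x - z))\<^sup>2)"
proof -
  interpret A: bounded_linear A by (rule A)
  interpret H: bounded_linear H by (rule H)
  obtain a where a: "a \<ge> 0" "\<And>v. norm (A v) \<le> norm v * a" using A.nonneg_bounded by blast
  obtain k where k: "k \<ge> 0" "\<And>v. norm (H v) \<le> norm v * k" using H.nonneg_bounded by blast
  define n where "n = norm c"
  \<comment> \<open>On the ball of radius \<open>R\<close>, \<open>b\<close> bounds the switching
    direction \<open>H v + g\<close> and \<open>B\<close> the velocity. \<open>C1\<close> is the
    factor in \<open>norm w' \<le> C1 * norm d\<close>, and \<open>C2\<close> the one that bounds
    \<open>norm d\<close> by \<open>norm w + \<bar>c \<bullet> d\<bar>\<close>.\<close>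
  define b where "b = R * k + norm g"
  define B where "B = R * a + norm e + b"
  define C1 where "C1 = 2 * (n * (B * k)) + 2 * (n * b * a) + 2 * (n * k * b)"
  define C2 where "C2 = (1 + b) / \<delta>"
  have n0: "n \<ge> 0" and b0: "b \<ge> 0" using R k(1) by (auto simp: n_def b_def)
  have B0: "B \<ge> 0" using R a(1) b0 by (auto simp: B_def)
  have C10: "C1 \<ge> 0" unfolding C1_def using n0 b0 B0 a(1) k(1) by simp
  have C20: "C2 \<ge> 0" unfolding C2_def using b0 \<delta> by simp
  have cn: "\<bar>c \<bullet> v\<bar> \<le> n * norm v" for v unfolding n_def by (rule Cauchy_Schwarz_ineq2)
  show thesis
  proof (rule that)
    \<comment> \<open>In the factor 4, one 2 comes from differentiating squares and the other from
      \<open>S\<^sup>2 \<le> 2 * (w \<bullet> w + (c \<bullet> d)\<^sup>2)\<close>.\<close>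
    show "0 \<le> 4 * (C1 + n * a) * C2" using C10 C20 n0 a(1) by simp
    fix x z m \<rho> x' z' w w'
    assume xR: "norm x \<le> R" and zR: "norm z \<le> R" and l: "0 \<le> m" "m \<le> (1::real)" and r: "0 \<le> \<rho>" "\<rho> \<le> (1::real)"
      and lc: "m = 0 \<or> c \<bullet> (x - z) \<le> 0" and rc: "\<rho> = 0 \<or> c \<bullet> (x - z) \<ge> 0"
      and dx: "\<delta> \<le> c \<bullet> (H x + g)" and dz: "\<delta> \<le> c \<bullet> (H z + g)"
      and x': "x' = A x + e + m *\<^sub>R (H x + g)" and z': "z' = A z + e + \<rho> *\<^sub>R (H z + g)"
      and w: "w = (c \<bullet> (H x + g)) *\<^sub>R (x - z) - (c \<bullet> (x - z)) *\<^sub>R (H x + g)"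
      and w': "w' = (c \<bullet> H x') *\<^sub>R (x - z) + (c \<bullet> (H x + g)) *\<^sub>R (x' - z')
           - (c \<bullet> (x' - z')) *\<^sub>R (H x + g) - (c \<bullet> (x - z)) *\<^sub>R H x'"
    define d where "d = x - z"
    define hx where "hx = H x + g"
    define hz where "hz = H z + g"
    have hb: "norm hx \<le> b" "norm hz \<le> b"
      using k(2)[of x] k(2)[of z] mult_right_mono[OF xR k(1)] mult_right_mono[OF zR k(1)]
        norm_triangle_ineq[of "H x" g] norm_triangle_ineq[of "H z" g]
      by (auto simp: hx_def hz_def b_def)
    have hxz: "hx = hz + H d" by (simp add: hx_def hz_def d_def H.diff)
    have "norm x' \<le> norm (A x) + norm e + norm (m *\<^sub>R hx)"
      unfolding x' hx_def by (intro norm_triangle_le order.refl add_mono norm_triangle_ineq)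
    moreover have "norm (m *\<^sub>R hx) \<le> b" using l hb(1) mult_mono[of m 1 "norm hx" b] by simp
    moreover have "norm (A x) \<le> R * a" using a(2)[of x] mult_right_mono[OF xR a(1)] by simp
    ultimately have x'B: "norm x' \<le> B" unfolding B_def by simp
    have Hx': "norm (H x') \<le> B * k" using k(2)[of x'] mult_right_mono[OF x'B k(1)] by simp
    have Hd: "norm (H d) \<le> k * norm d" and Ad: "norm (A d) \<le> a * norm d"
      using k(2)[of d] a(2)[of d] by (simp_all add: mult.commute)
    have d': "x' - z' = A d + m *\<^sub>R hx - \<rho> *\<^sub>R hz"
      by (simp add: x' z' d_def hx_def hz_def A.diff)
    \<comment> \<open>The \<open>m\<close> term of \<open>x' - z'\<close> is a multiple of
      \<open>hx\<close>, which the projection kills. In the \<open>\<rho>\<close> term,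
      \<open>hx = hz + H d\<close> cancels everything that does not vanish with
      \<open>d\<close>.\<close>
    have w'e: "w' = ((c \<bullet> H x') *\<^sub>R d - (c \<bullet> d) *\<^sub>R H x') + ((c \<bullet> hx) *\<^sub>R A d - (c \<bullet> A d) *\<^sub>R hx)
        - \<rho> *\<^sub>R ((c \<bullet> H d) *\<^sub>R hz - (c \<bullet> hz) *\<^sub>R H d)"
      unfolding w' d' d_def[symmetric] hx_def[symmetric] unfolding hxz
      by (simp add: algebra_simps)
    have pr: "norm ((c \<bullet> u) *\<^sub>R v) \<le> n * p * q" if "norm u \<le> p" "norm v \<le> q" for u v p q
    proof -
      have "\<bar>c \<bullet> u\<bar> \<le> n * p" using cn[of u] mult_left_mono[OF that(1) n0] by simp
      moreover have "0 \<le> n * p" using n0 that(1) norm_ge_zero[of u] by (intro mult_nonneg_nonneg) linarith+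
      ultimately show ?thesis using that(2) by (simp add: mult_mono)
    qed
    have "norm w' \<le> (norm ((c \<bullet> H x') *\<^sub>R d) + norm ((c \<bullet> d) *\<^sub>R H x'))
        + (norm ((c \<bullet> hx) *\<^sub>R A d) + norm ((c \<bullet> A d) *\<^sub>R hx))
        + \<rho> * (norm ((c \<bullet> H d) *\<^sub>R hz) + norm ((c \<bullet> hz) *\<^sub>R H d))"
    proof -
      have "norm (\<rho> *\<^sub>R ((c \<bullet> H d) *\<^sub>R hz - (c \<bullet> hz) *\<^sub>R H d))
          \<le> \<rho> * (norm ((c \<bullet> H d) *\<^sub>R hz) + norm ((c \<bullet> hz) *\<^sub>R H d))"
        unfolding norm_scaleR[of \<rho>] abs_of_nonneg[OF r(1)]
        by (rule mult_left_mono[OF norm_triangle_ineq4 r(1)])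
      then show ?thesis unfolding w'e
        by (intro order.trans[OF norm_triangle_ineq4] order.trans[OF norm_triangle_ineq] add_mono norm_triangle_ineq4)
    qed
    also have "\<dots> \<le> (n * (B * k) * norm d + n * norm d * (B * k))
        + (n * b * (a * norm d) + n * (a * norm d) * b)
        + 1 * (n * (k * norm d) * b + n * b * (k * norm d))"
      using r Hx' hb Hd Ad by (intro add_mono mult_mono pr order.refl) auto
    also have "\<dots> = C1 * norm d" by (simp add: C1_def algebra_simps)
    finally have w'b: "norm w' \<le> C1 * norm d" .
    define S where "S = norm w + \<bar>c \<bullet> d\<bar>"
    have S0: "S \<ge> 0" by (simp add: S_def)
    \<comment> \<open>The projection can be undone: \<open>c \<bullet> hx\<close> is at least
      \<open>\<delta>\<close>, so \<open>d\<close> is recovered from \<open>w\<close> and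
      \<open>c \<bullet> d\<close>.\<close>
    have "\<delta> * norm d \<le> norm ((c \<bullet> hx) *\<^sub>R d)"
      using dx \<delta> by (simp add: hx_def mult_right_mono)
    also have "(c \<bullet> hx) *\<^sub>R d = w + (c \<bullet> d) *\<^sub>R hx" by (simp add: w d_def hx_def)
    also have "norm \<dots> \<le> norm w + \<bar>c \<bullet> d\<bar> * b"
      using hb(1) by (intro order.trans[OF norm_triangle_ineq]) (simp add: mult_left_mono)
    also have "\<dots> \<le> (1 + b) * S"
      unfolding S_def using b0 by (simp add: algebra_simps)
    finally have dS: "norm d \<le> C2 * S" using \<delta> by (simp add: C2_def field_simps)
    have "(c \<bullet> d) * (c \<bullet> (x' - z')) = (c \<bullet> d) * (c \<bullet> A d) + m * (c \<bullet> d) * (c \<bullet> hx) - \<rho> * (c \<bullet> d) * (c \<bullet> hz)"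
      unfolding d' by (simp add: algebra_simps)
    moreover have "m * (c \<bullet> d) * (c \<bullet> hx) \<le> 0"
    proof (rule mult_nonpos_nonneg)
      show "m * (c \<bullet> d) \<le> 0" using lc l by (auto simp: d_def mult_nonneg_nonpos)
      show "0 \<le> c \<bullet> hx" using dx \<delta> by (simp add: hx_def)
    qed
    moreover have "\<rho> * (c \<bullet> d) * (c \<bullet> hz) \<ge> 0"
    proof (rule mult_nonneg_nonneg)
      show "\<rho> * (c \<bullet> d) \<ge> 0" using rc r by (auto simp: d_def)
      show "0 \<le> c \<bullet> hz" using dz \<delta> by (simp add: hz_def)
    qed
    moreover have "(c \<bullet> d) * (c \<bullet> A d) \<le> \<bar>c \<bullet> d\<bar> * (n * (a * norm d))"
    proof -
      have "(c \<bullet> d) * (c \<bullet> A d) \<le> \<bar>c \<bullet> d\<bar> * \<bar>c \<bullet> A d\<bar>" by (simp add: abs_mult[symmetric])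
      also have "\<dots> \<le> \<bar>c \<bullet> d\<bar> * (n * (a * norm d))"
        using cn[of "A d"] mult_left_mono[OF Ad n0] by (intro mult_left_mono) auto
      finally show ?thesis .
    qed
    ultimately have cd: "(c \<bullet> d) * (c \<bullet> (x' - z')) \<le> \<bar>c \<bullet> d\<bar> * (n * (a * norm d))" by linarith
    have "w \<bullet> w' \<le> norm w * (C1 * norm d)"
      using norm_cauchy_schwarz[of w w'] mult_left_mono[OF w'b norm_ge_zero[of w]] by simp
    also have "\<dots> \<le> S * (C1 * (C2 * S))"
      using dS C10 S0 by (intro mult_mono mult_left_mono) (auto simp: S_def)
    finally have 1: "w \<bullet> w' \<le> C1 * C2 * S\<^sup>2" by (simp add: power2_eq_square algebra_simps)
    have "\<bar>c \<bullet> d\<bar> * (n * (a * norm d)) \<le> S * (n * (a * (C2 * S)))"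
      using dS S0 n0 a(1) by (intro mult_mono mult_left_mono) (auto simp: S_def)
    with cd have 2: "(c \<bullet> d) * (c \<bullet> (x' - z')) \<le> n * a * C2 * S\<^sup>2"
      by (simp add: power2_eq_square algebra_simps)
    have "S\<^sup>2 \<le> 2 * (w \<bullet> w + (c \<bullet> d)\<^sup>2)"
      using sum_squares_bound[of "norm w" "\<bar>c \<bullet> d\<bar>"]
      by (simp add: S_def power2_sum dot_square_norm)
    then have "2 * (C1 + n * a) * C2 * S\<^sup>2 \<le> 2 * (C1 + n * a) * C2 * (2 * (w \<bullet> w + (c \<bullet> d)\<^sup>2))"
      using C10 C20 n0 a(1) by (intro mult_left_mono) auto
    moreover have "2 * (w \<bullet> w') + 2 * ((c \<bullet> d) * (c \<bullet> (x' - z'))) \<le> 2 * (C1 + n * a) * C2 * S\<^sup>2"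
      using 1 2 by (simp add: algebra_simps)
    ultimately show "2 * (w \<bullet> w') + 2 * ((c \<bullet> (x - z)) * (c \<bullet> (x' - z')))
        \<le> 4 * (C1 + n * a) * C2 * (w \<bullet> w + (c \<bullet> (x - z))\<^sup>2)"
      unfolding d_def[symmetric] by (simp add: algebra_simps)
  qed
qed

text \<open>A multiplier acts only when its push along the switching direction brings
  \<open>c \<bullet> x\<close> and \<open>c \<bullet> z\<close> together, so the Lyapunov function
  \<open>V\<close> grows at rate at most \<open>C * V\<close> and starts at 0. The multipliers are
  quantified inside the almost-everywhere statement and may depend on time arbitrarily.\<close>

lemma reflected_flow_right_unique:
  fixes A H :: "'a::real_inner \<Rightarrow> 'a" and x z :: "real \<Rightarrow> 'a"
  assumes A: "bounded_linear A" and H: "bounded_linear H" and \<delta>: "\<delta> > 0" and T: "T > 0"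
    and acx: "abs_continuous_on_interval x 0 T" and acz: "abs_continuous_on_interval z 0 T"
    and init: "x 0 = z 0"
    and xR: "\<And>t. t \<in> {0..T} \<Longrightarrow> norm (x t) \<le> R" and zR: "\<And>t. t \<in> {0..T} \<Longrightarrow> norm (z t) \<le> R"
    and xd: "\<And>t. t \<in> {0..T} \<Longrightarrow> \<delta> \<le> c \<bullet> (H (x t) + g)"
    and zd: "\<And>t. t \<in> {0..T} \<Longrightarrow> \<delta> \<le> c \<bullet> (H (z t) + g)"
    and ode: "AE t in lebesgue. t \<in> {0<..<T} \<longrightarrow> (\<exists>m \<rho>.
        (x has_vector_derivative A (x t) + e + m *\<^sub>R (H (x t) + g)) (at t) \<and>
        (z has_vector_derivative A (z t) + e + \<rho> *\<^sub>R (H (z t) + g)) (at t) \<and>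
        0 \<le> m \<and> m \<le> 1 \<and> 0 \<le> \<rho> \<and> \<rho> \<le> 1 \<and>
        (m = 0 \<or> c \<bullet> (x t - z t) \<le> 0) \<and> (\<rho> = 0 \<or> c \<bullet> (x t - z t) \<ge> 0))"
  shows "\<exists>\<epsilon>>0. \<forall>t\<in>{0..<\<epsilon>}. x t = z t"
proof -
  interpret A: bounded_linear A by (rule A)
  interpret H: bounded_linear H by (rule H)
  have R: "R \<ge> 0" using order.trans[OF norm_ge_zero xR[of 0]] T by simp
  obtain a where a: "a \<ge> 0" "\<And>v. norm (A v) \<le> norm v * a" using A.nonneg_bounded by blast
  obtain k where k: "k \<ge> 0" "\<And>v. norm (H v) \<le> norm v * k" using H.nonneg_bounded by blast
  define B where "B = R * a + norm e + (R * k + norm g)"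
  have B: "B \<ge> 0" using R a(1) k(1) by (simp add: B_def)
  have fb: "norm (A v + e + m *\<^sub>R (H v + g)) \<le> B" if v: "norm v \<le> R" and m: "0 \<le> m" "m \<le> 1" for v m
  proof -
    have "norm (H v + g) \<le> R * k + norm g"
      using norm_triangle_ineq[of "H v" g] k(2)[of v] mult_right_mono[OF v k(1)] by linarith
    then have "norm (m *\<^sub>R (H v + g)) \<le> R * k + norm g"
      using m mult_mono[of m 1 "norm (H v + g)" "R * k + norm g"] by simp
    moreover have "norm (A v + e) \<le> R * a + norm e"
      using norm_triangle_ineq[of "A v" e] a(2)[of v] mult_right_mono[OF v a(1)] by linarith
    ultimately show ?thesis
      using norm_triangle_ineq[of "A v + e" "m *\<^sub>R (H v + g)"] unfolding B_def by linarith
  qed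
  have lx: "B-lipschitz_on {0..T} x"
  proof (rule abs_continuous_bounded_deriv_imp_lipschitz[OF acx B])
    show "AE t in lebesgue. t \<in> {0<..<T} \<longrightarrow> (\<exists>v. (x has_vector_derivative v) (at t) \<and> norm v \<le> B)"
      using ode
    proof eventually_elim
      case (elim t)
      then show ?case using fb[OF xR[of t]] by fastforce
    qed
  qed
  have lz: "B-lipschitz_on {0..T} z"
  proof (rule abs_continuous_bounded_deriv_imp_lipschitz[OF acz B])
    show "AE t in lebesgue. t \<in> {0<..<T} \<longrightarrow> (\<exists>v. (z has_vector_derivative v) (at t) \<and> norm v \<le> B)"
      using ode
    proof eventually_elim
      case (elim t)
      then show ?case using fb[OF zR[of t]] by fastforce
    qed
  qed
  define d where "d t = x t - z t" for t
  define h where "h t = H (x t) + g" for t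
  define w where "w t = (c \<bullet> h t) *\<^sub>R d t - (c \<bullet> d t) *\<^sub>R h t" for t
  \<comment> \<open>The square is written as a product so that the bilinear rule for Lipschitz
    functions applies to it.\<close>
  define V where "V t = w t \<bullet> w t + (c \<bullet> d t) * (c \<bullet> d t)" for t
  let ?lip = "\<lambda>f. \<exists>L. L-lipschitz_on {0..T} f"
  note bil = lipschitz_on_bilinear[OF _ bounded_closed_interval]
  have ld: "?lip d" unfolding d_def using lipschitz_on_diff[OF lx lz] by blast
  obtain L where "L-lipschitz_on UNIV H" using H.lipschitz_boundE[of UNIV] by blast
  then have "(L * B)-lipschitz_on {0..T} (\<lambda>t. H (x t))"
    by (rule lipschitz_on_compose2[OF lx lipschitz_on_subset[OF _ subset_UNIV]])
  then have lh: "?lip h"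
    unfolding h_def using lipschitz_on_add[OF _ lipschitz_on_constant[of "{0..T}" g]] by blast
  have lc: "?lip (\<lambda>t. c)" using lipschitz_on_constant by blast
  have lch: "?lip (\<lambda>t. c \<bullet> h t)" by (rule bil[OF bounded_bilinear_inner lc lh])
  have lcd: "?lip (\<lambda>t. c \<bullet> d t)" by (rule bil[OF bounded_bilinear_inner lc ld])
  obtain L1 L2 where "L1-lipschitz_on {0..T} (\<lambda>t. (c \<bullet> h t) *\<^sub>R d t)" "L2-lipschitz_on {0..T} (\<lambda>t. (c \<bullet> d t) *\<^sub>R h t)"
    using bil[OF bounded_bilinear_scaleR lch ld] bil[OF bounded_bilinear_scaleR lcd lh] by blast
  then have lw: "?lip w" unfolding w_def using lipschitz_on_diff by blast
  obtain L3 L4 where "L3-lipschitz_on {0..T} (\<lambda>t. w t \<bullet> w t)" "L4-lipschitz_on {0..T} (\<lambda>t. (c \<bullet> d t) * (c \<bullet> d t))"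
    using bil[OF bounded_bilinear_inner lw lw] bil[OF bounded_bilinear_mult lcd lcd] by blast
  then obtain L5 where lV: "L5-lipschitz_on {0..T} V" unfolding V_def using lipschitz_on_add by blast
  have V0: "V t \<ge> 0" for t by (simp add: V_def)
  have V00: "V 0 = 0" by (simp add: V_def w_def d_def init)
  obtain C where C: "C \<ge> 0" and Cb: "\<And>x z m \<rho> x' z' w w'. \<lbrakk>
      norm x \<le> R; norm z \<le> R; 0 \<le> m; m \<le> 1; 0 \<le> \<rho>; \<rho> \<le> 1;
      m = 0 \<or> c \<bullet> (x - z) \<le> 0; \<rho> = 0 \<or> c \<bullet> (x - z) \<ge> 0;
      \<delta> \<le> c \<bullet> (H x + g); \<delta> \<le> c \<bullet> (H z + g);
      x' = A x + e + m *\<^sub>R (H x + g); z' = A z + e + \<rho> *\<^sub>R (H z + g);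
      w = (c \<bullet> (H x + g)) *\<^sub>R (x - z) - (c \<bullet> (x - z)) *\<^sub>R (H x + g);
      w' = (c \<bullet> H x') *\<^sub>R (x - z) + (c \<bullet> (H x + g)) *\<^sub>R (x' - z')
           - (c \<bullet> (x' - z')) *\<^sub>R (H x + g) - (c \<bullet> (x - z)) *\<^sub>R H x'\<rbrakk> \<Longrightarrow>
      2 * (w \<bullet> w') + 2 * ((c \<bullet> (x - z)) * (c \<bullet> (x' - z')))
        \<le> C * (w \<bullet> w + (c \<bullet> (x - z))\<^sup>2)"
  proof (rule lyapunov_bound[OF A H \<delta> R, where c = c and e = e and g = g], goal_cases)
    case (1 C)
    show ?case by (rule 1(1)[OF 1(2)], rule 1(3))
  qed
  have dV: "AE t in lebesgue. t \<in> {0<..<T} \<longrightarrow> (\<exists>D\<le>C * V t. (V has_real_derivative D) (at t))"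
    using ode
  proof eventually_elim
    case (elim t)
    show ?case
    proof
      assume t: "t \<in> {0<..<T}"
      then obtain m \<rho> where m: "0 \<le> m" "m \<le> 1" "m = 0 \<or> c \<bullet> (x t - z t) \<le> 0"
        and \<rho>: "0 \<le> \<rho>" "\<rho> \<le> 1" "\<rho> = 0 \<or> c \<bullet> (x t - z t) \<ge> 0"
        and dx: "(x has_vector_derivative A (x t) + e + m *\<^sub>R (H (x t) + g)) (at t)"
        and dz: "(z has_vector_derivative A (z t) + e + \<rho> *\<^sub>R (H (z t) + g)) (at t)"
        using elim by blast
      define x' where "x' = A (x t) + e + m *\<^sub>R (H (x t) + g)"
      define z' where "z' = A (z t) + e + \<rho> *\<^sub>R (H (z t) + g)"
      define w' where "w' = (c \<bullet> H x') *\<^sub>R d t + (c \<bullet> h t) *\<^sub>R (x' - z')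
           - (c \<bullet> (x' - z')) *\<^sub>R h t - (c \<bullet> d t) *\<^sub>R H x'"
      have dd: "(d has_vector_derivative x' - z') (at t)"
        unfolding d_def x'_def z'_def by (intro derivative_intros dx dz)
      have dh: "(h has_vector_derivative H x') (at t)"
        unfolding h_def x'_def
        using has_vector_derivative_add[OF H.has_vector_derivative[OF dx] has_vector_derivative_const[of g]] by simp
      have dch: "((\<lambda>t. c \<bullet> h t) has_real_derivative c \<bullet> H x') (at t)"
        using bounded_linear.has_vector_derivative[OF bounded_linear_inner_right dh]
        by (simp add: has_real_derivative_iff_has_vector_derivative)
      have dcd: "((\<lambda>t. c \<bullet> d t) has_real_derivative c \<bullet> (x' - z')) (at t)"
        using bounded_linear.has_vector_derivative[OF bounded_linear_inner_right dd]
        by (simp add: has_real_derivative_iff_has_vector_derivative)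
      have dw: "(w has_vector_derivative w') (at t)"
        unfolding w_def
        by (rule has_vector_derivative_eq_rhs[OF has_vector_derivative_diff[OF
              has_vector_derivative_scaleR[OF dch dd] has_vector_derivative_scaleR[OF dcd dh]]])
          (simp add: w'_def)
      have dww: "((\<lambda>t. w t \<bullet> w t) has_real_derivative w t \<bullet> w' + w' \<bullet> w t) (at t)"
        using bounded_bilinear.has_vector_derivative[OF bounded_bilinear_inner dw dw]
        by (simp add: has_real_derivative_iff_has_vector_derivative)
      have "(V has_real_derivative (w t \<bullet> w' + w' \<bullet> w t)
           + ((c \<bullet> (x' - z')) * (c \<bullet> d t) + (c \<bullet> (x' - z')) * (c \<bullet> d t))) (at t)"
        unfolding V_def by (intro DERIV_add dww DERIV_mult dcd)
      moreover have "(w t \<bullet> w' + w' \<bullet> w t)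
           + ((c \<bullet> (x' - z')) * (c \<bullet> d t) + (c \<bullet> (x' - z')) * (c \<bullet> d t)) \<le> C * V t"
        using Cb[OF xR zR m(1,2) \<rho>(1,2) m(3) \<rho>(3) xd zd x'_def z'_def w_def[unfolded d_def h_def]
            w'_def[unfolded d_def h_def]] t
        by (simp add: V_def d_def power2_eq_square inner_commute[of w'] mult.commute[of "c \<bullet> (x' - z')"])
      ultimately show "\<exists>D\<le>C * V t. (V has_real_derivative D) (at t)" by blast
    qed
  qed
  \<comment> \<open>On an interval this short, the increment bound at the maximum of
    \<open>V\<close> is at most half of that maximum, which forces it to be 0. This replaces an
    exponential Gronwall bound.\<close>
  define \<tau> where "\<tau> = min T (1 / (2 * (C + 1)))"
  have \<tau>: "\<tau> > 0" "\<tau> \<le> T" "C * \<tau> \<le> 1 / 2"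
  proof -
    show "\<tau> > 0" "\<tau> \<le> T" using T C by (auto simp: \<tau>_def)
    have "C * \<tau> \<le> C * (1 / (2 * (C + 1)))" using C by (intro mult_left_mono) (auto simp: \<tau>_def)
    also have "\<dots> \<le> 1 / 2" using C by (simp add: field_simps)
    finally show "C * \<tau> \<le> 1 / 2" .
  qed
  have "continuous_on {0..\<tau>} V"
    using continuous_on_subset[OF lipschitz_on_continuous_on[OF lV]] \<tau> by auto
  then obtain s where s: "s \<in> {0..\<tau>}" and smax: "\<And>t. t \<in> {0..\<tau>} \<Longrightarrow> V t \<le> V s"
    using continuous_attains_sup[of "{0..\<tau>}" V] \<tau> by auto
  have "V s - V 0 \<le> C * V s * (s - 0)"
  proof (rule abs_continuous_increment_le)
    show "abs_continuous_on_interval V 0 s"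
      using s \<tau> by (intro abs_continuous_subset[OF lipschitz_on_imp_abs_continuous[OF lV]]) auto
    show "0 \<le> s" "0 \<le> C * V s" using s C V0 by auto
    show "AE t in lebesgue. t \<in> {0<..<s} \<longrightarrow> (\<exists>D\<le>C * V s. (V has_real_derivative D) (at t))"
      using dV
    proof eventually_elim
      case (elim t)
      show ?case
      proof
        assume t: "t \<in> {0<..<s}"
        then have "C * V t \<le> C * V s" using smax[of t] s C by (intro mult_left_mono) auto
        moreover obtain D where "D \<le> C * V t" "(V has_real_derivative D) (at t)" using elim t s \<tau> by auto
        ultimately show "\<exists>D\<le>C * V s. (V has_real_derivative D) (at t)" by (auto intro: order.trans)
      qed
    qed
  qed
  also have "\<dots> \<le> C * V s * \<tau>" using s C V0[of s] by (intro mult_left_mono) auto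
  also have "\<dots> = C * \<tau> * V s" by simp
  also have "\<dots> \<le> 1 / 2 * V s" using \<tau>(3) V0 by (intro mult_right_mono) auto
  finally have "V s \<le> 0" using V00 by simp
  have "x t = z t" if t: "t \<in> {0..<\<tau>}" for t
  proof -
    have "V t = 0" using smax[of t] \<open>V s \<le> 0\<close> V0[of t] t by auto
    then have "w t \<bullet> w t = 0" and cd: "(c \<bullet> d t) * (c \<bullet> d t) = 0"
      unfolding V_def using inner_ge_zero[of "w t"] zero_le_square[of "c \<bullet> d t"] by linarith+
    then have "w t = 0" and "c \<bullet> d t = 0" by simp_all
    then have "(c \<bullet> h t) *\<^sub>R d t = 0" by (simp add: w_def)
    moreover have "c \<bullet> h t > 0" using xd[of t] t \<tau> \<delta> by (simp add: h_def)
    ultimately show ?thesis by (simp add: d_def)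
  qed
  then show ?thesis using \<tau>(1) by blast
qed

text \<open>Away from sliding both solutions follow the same mode, and only uniqueness for an affine
  differential equation remains.\<close>

lemma affine_flow_right_unique:
  fixes x z :: "real \<Rightarrow> 'a::euclidean_space"
  assumes A: "bounded_linear A" and T: "T > 0"
    and acx: "abs_continuous_on_interval x 0 T" and acz: "abs_continuous_on_interval z 0 T"
    and init: "x 0 = z 0"
    and xR: "\<And>t. t \<in> {0..T} \<Longrightarrow> norm (x t) \<le> R" and zR: "\<And>t. t \<in> {0..T} \<Longrightarrow> norm (z t) \<le> R"
    and odex: "AE t in lebesgue. t \<in> {0<..<T} \<longrightarrow> (x has_vector_derivative A (x t) + e) (at t)"
    and odez: "AE t in lebesgue. t \<in> {0<..<T} \<longrightarrow> (z has_vector_derivative A (z t) + e) (at t)"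
  shows "\<exists>\<epsilon>>0. \<forall>t\<in>{0..<\<epsilon>}. x t = z t"
proof -
  \<comment> \<open>With \<open>m = \<rho> = 0\<close> throughout, any constant field transversal to \<open>u\<close> can play the role of \<open>h\<close>.\<close>
  obtain u :: 'a where u: "u \<in> Basis" using nonempty_Basis by blast
  show ?thesis
  proof (rule reflected_flow_right_unique[where H = "\<lambda>v. 0" and c = u and g = u and \<delta> = 1,
        OF A bounded_linear_zero _ T acx acz init xR zR])
    show "AE t in lebesgue. t \<in> {0<..<T} \<longrightarrow> (\<exists>m \<rho>.
        (x has_vector_derivative A (x t) + e + m *\<^sub>R (0 + u)) (at t) \<and>
        (z has_vector_derivative A (z t) + e + \<rho> *\<^sub>R (0 + u)) (at t) \<and>
        0 \<le> m \<and> m \<le> 1 \<and> 0 \<le> \<rho> \<and> \<rho> \<le> 1 \<and>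
        (m = 0 \<or> u \<bullet> (x t - z t) \<le> 0) \<and> (\<rho> = 0 \<or> u \<bullet> (x t - z t) \<ge> 0))"
      using odex odez by eventually_elim (auto intro!: exI[of _ 0])
  qed (use u in auto)
qed

subsection \<open>Filippov solutions near the switching plane\<close>

lemma filippov_solutionD:
  assumes "filippov_solution G \<xi> x"
  shows "a \<le> b \<Longrightarrow> abs_continuous_on_interval x a b" "x 0 = \<xi>"
    "AE t in lebesgue. \<exists>v\<in>G (x t). (x has_vector_derivative v) (at t)"
  using assms by (auto simp: filippov_solution_def)

text \<open>Strict inequalities at the initial state persist for a short time; the later proofs
  collect them in one open set \<open>W\<close>.\<close>

lemma filippov_solution_stays:
  assumes x: "filippov_solution G \<xi> x" and W: "open W" "\<xi> \<in> W"
  shows "\<exists>T>0. \<forall>t\<in>{0..T}. x t \<in> W"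
proof -
  have "continuous_on {0..1} x"
    by (intro abs_continuous_imp_continuous_on filippov_solutionD[OF x]) simp
  moreover obtain r where r: "r > 0" "ball \<xi> r \<subseteq> W" using W open_contains_ball by blast
  ultimately obtain d where d: "d > 0" "\<And>t. \<lbrakk>t \<in> {0..1}; dist t 0 < d\<rbrakk> \<Longrightarrow> dist (x t) (x 0) < r"
    unfolding continuous_on_iff using r(1) by (metis atLeastAtMost_iff order.refl zero_le_one)
  show ?thesis
  proof (intro exI[of _ "min 1 (d / 2)"] conjI ballI)
    show "0 < min 1 (d / 2)" using d(1) by simp
    fix t assume "t \<in> {0..min 1 (d / 2)}"
    then have "dist (x t) \<xi> < r" using d(2)[of t] d(1) filippov_solutionD(2)[OF x] by auto
    then show "x t \<in> W" using r(2) by (auto simp: dist_commute)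
  qed
qed

text \<open>If \<open>y\<close> were negative at \<open>t1\<close>, it would stay negative after the
  last earlier time with \<open>y \<ge> 0\<close>. There only the first mode acts, and it makes
  \<open>y\<close> increase.\<close>

lemma filippov_nonneg_side_invariant:
  fixes A1 A2 :: "real^'n^'n"
  assumes x: "filippov_solution (pwa_map A1 A2 e1 e2 c f) \<xi> x"
    and g1: "\<And>t. t \<in> {0..T} \<Longrightarrow> c \<bullet> (A1 *v x t + e1) > 0"
    and init: "c \<bullet> \<xi> + f \<ge> 0" and t1: "t1 \<in> {0..T}"
  shows "c \<bullet> x t1 + f \<ge> 0"
proof (rule ccontr)
  assume neg: "\<not> c \<bullet> x t1 + f \<ge> 0"
  define y where "y t = c \<bullet> x t + f" for t
  define S where "S = {t \<in> {0..t1}. y t \<ge> 0}"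
  have "continuous_on {0..t1} y" unfolding y_def
    using t1 by (intro continuous_intros abs_continuous_imp_continuous_on filippov_solutionD[OF x]) auto
  then have "closed ({0..t1} \<inter> y -` {0..})"
    by (intro continuous_closed_preimage) auto
  then have "compact ({0..t1} \<inter> ({0..t1} \<inter> y -` {0..}))"
    by (intro compact_Int_closed compact_Icc)
  moreover have "{0..t1} \<inter> ({0..t1} \<inter> y -` {0..}) = S" by (auto simp: S_def)
  ultimately have "compact S" by simp
  moreover have "0 \<in> S" using t1 init filippov_solutionD(2)[OF x] by (simp add: S_def y_def)
  ultimately obtain s where s: "s \<in> S" and smax: "\<And>t. t \<in> S \<Longrightarrow> t \<le> s"
    using compact_attains_sup[of S] by blast
  have s0: "0 \<le> s" "s \<le> t1" "y s \<ge> 0" using s by (auto simp: S_def)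
  \<comment> \<open>The increment bound is applied to \<open>- y\<close> with \<open>B = 0\<close>,
    so \<open>y\<close> does not decrease from \<open>s\<close> to \<open>t1\<close>.\<close>
  have "(- y t1) - (- y s) \<le> 0 * (t1 - s)"
  proof (rule abs_continuous_increment_le)
    show "abs_continuous_on_interval (\<lambda>t. - y t) s t1"
    proof (rule abs_continuous_dominated[OF filippov_solutionD(1)[OF x s0(2)], of _ "norm c"])
      fix a b
      have "- y b - - y a = - (c \<bullet> (x b - x a))" by (simp add: y_def inner_diff_right)
      then show "norm (- y b - - y a) \<le> norm c * norm (x b - x a)"
        using Cauchy_Schwarz_ineq2[of c "x b - x a"] by simp
    qed
    show "AE t in lebesgue. t \<in> {s<..<t1} \<longrightarrow> (\<exists>D\<le>0. ((\<lambda>t. - y t) has_real_derivative D) (at t))"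
      using filippov_solutionD(3)[OF x]
    proof eventually_elim
      case (elim t)
      show ?case
      proof
        assume t: "t \<in> {s<..<t1}"
        then have "t \<notin> S" using smax by force
        then have "c \<bullet> x t + f < 0" using t s0 by (auto simp: S_def y_def)
        then have d: "(x has_vector_derivative A1 *v x t + e1) (at t)"
          using elim by (auto simp: pwa_map_def)
        have "((\<lambda>t. c \<bullet> x t) has_real_derivative c \<bullet> (A1 *v x t + e1)) (at t)"
          using bounded_linear.has_vector_derivative[OF bounded_linear_inner_right d]
          by (simp add: has_real_derivative_iff_has_vector_derivative)
        then have "((\<lambda>t. - y t) has_real_derivative - (c \<bullet> (A1 *v x t + e1) + 0)) (at t)"
          unfolding y_def by (intro DERIV_minus DERIV_add DERIV_const)
        moreover have "- (c \<bullet> (A1 *v x t + e1) + 0) \<le> 0" using g1[of t] t s0 t1 by auto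
        ultimately show "\<exists>D\<le>0. ((\<lambda>t. - y t) has_real_derivative D) (at t)" by blast
      qed
    qed
  qed (use s0 in auto)
  then show False using neg s0 by (simp add: y_def)
qed

text \<open>\<open>m\<close> is the weight of the first mode in the convex hull. On the plane,
  \<open>c \<bullet> x\<close> has a local minimum, so its derivative vanishes; this is why
  \<open>t\<close> is an interior time.\<close>

lemma pwa_velocity_nonneg_side:
  fixes A1 A2 :: "real^'n^'n"
  assumes nonneg: "\<And>s. s \<in> {0..T} \<Longrightarrow> c \<bullet> x s + f \<ge> 0" and t: "t \<in> {0<..<T}"
    and v: "v \<in> pwa_map A1 A2 e1 e2 c f (x t)" and d: "(x has_vector_derivative v) (at t)"
  obtains m where "0 \<le> m" "m \<le> 1" "v = A2 *v x t + e2 + m *\<^sub>R ((A1 - A2) *v x t + (e1 - e2))"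
    "m = 0 \<or> c \<bullet> x t + f = 0" "c \<bullet> x t + f = 0 \<Longrightarrow> c \<bullet> v = 0"
proof (cases "c \<bullet> x t + f = 0")
  case False
  then have "v = A2 *v x t + e2" using v nonneg[of t] t by (auto simp: pwa_map_def)
  then show ?thesis using that[of 0] False by simp
next
  case True
  then have "v \<in> convex hull {A1 *v x t + e1, A2 *v x t + e2}" using v by (simp add: pwa_map_def)
  then obtain a b where ab: "0 \<le> a" "0 \<le> b" "a + b = 1" "v = a *\<^sub>R (A1 *v x t + e1) + b *\<^sub>R (A2 *v x t + e2)"
    unfolding convex_hull_2 by blast
  have b: "b = 1 - a" using ab(3) by simp
  have v': "v = A2 *v x t + e2 + a *\<^sub>R ((A1 - A2) *v x t + (e1 - e2))"
    unfolding ab(4) b by (simp add: algebra_simps matrix_vector_mult_diff_rdistrib)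
  have der: "((\<lambda>t. c \<bullet> x t) has_real_derivative c \<bullet> v) (at t)"
    using bounded_linear.has_vector_derivative[OF bounded_linear_inner_right d]
    by (simp add: has_real_derivative_iff_has_vector_derivative)
  have "c \<bullet> v = 0"
  proof (rule DERIV_local_min[OF der])
    show "0 < min t (T - t)" using t by simp
    show "\<forall>s. \<bar>t - s\<bar> < min t (T - t) \<longrightarrow> c \<bullet> x t \<le> c \<bullet> x s"
    proof (intro allI impI)
      fix s assume "\<bar>t - s\<bar> < min t (T - t)"
      then have "s \<in> {0..T}" by (auto simp: abs_less_iff)
      from nonneg[OF this] True show "c \<bullet> x t \<le> c \<bullet> x s" by linarith
    qed
  qed
  then show ?thesis using that[of a] ab v' True by auto
qed

text \<open>Off the plane, continuity suffices. On it, two positive normal velocities make every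
  convex combination positive, whereas a velocity on the plane has zero normal component; so the
  first mode has weight 0 at almost every time.\<close>

lemma filippov_affine_near:
  fixes A1 A2 :: "real^'n^'n"
  assumes x: "filippov_solution (pwa_map A1 A2 e1 e2 c f) \<xi> x"
    and side: "c \<bullet> \<xi> + f > 0 \<or> c \<bullet> \<xi> + f = 0 \<and> c \<bullet> (A1 *v \<xi> + e1) > 0 \<and> c \<bullet> (A2 *v \<xi> + e2) > 0"
  shows "\<exists>T>0. (\<forall>t\<in>{0..T}. norm (x t) \<le> norm \<xi> + 1) \<and>
    (AE t in lebesgue. t \<in> {0<..<T} \<longrightarrow> (x has_vector_derivative A2 *v x t + e2) (at t))"
  using side
proof
  assume pos: "c \<bullet> \<xi> + f > 0"
  define W where "W = {v. norm v < norm \<xi> + 1 \<and> 0 < c \<bullet> v + f}"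
  have "open W" unfolding W_def by (intro open_Collect_conj open_Collect_less continuous_intros)
  then obtain T where T: "T > 0" "\<And>t. t \<in> {0..T} \<Longrightarrow> x t \<in> W"
    using filippov_solution_stays[OF x, of W] pos by (auto simp: W_def)
  have "AE t in lebesgue. t \<in> {0<..<T} \<longrightarrow> (x has_vector_derivative A2 *v x t + e2) (at t)"
    using filippov_solutionD(3)[OF x]
  proof eventually_elim
    case (elim t)
    then show ?case using T(2)[of t] by (auto simp: W_def pwa_map_def)
  qed
  moreover have "norm (x t) \<le> norm \<xi> + 1" if "t \<in> {0..T}" for t
    using T(2)[OF that] by (simp add: W_def)
  ultimately show ?thesis using T(1) by blast
next
  assume cross: "c \<bullet> \<xi> + f = 0 \<and> c \<bullet> (A1 *v \<xi> + e1) > 0 \<and> c \<bullet> (A2 *v \<xi> + e2) > 0"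
  define W where "W = {v. norm v < norm \<xi> + 1 \<and> 0 < c \<bullet> (A1 *v v + e1) \<and> 0 < c \<bullet> (A2 *v v + e2)}"
  have "open W" unfolding W_def by (intro open_Collect_conj open_Collect_less continuous_intros)
  then obtain T where T: "T > 0" "\<And>t. t \<in> {0..T} \<Longrightarrow> x t \<in> W"
    using filippov_solution_stays[OF x, of W] cross by (auto simp: W_def)
  have nonneg: "c \<bullet> x t + f \<ge> 0" if "t \<in> {0..T}" for t
    using filippov_nonneg_side_invariant[OF x _ _ that] T(2) cross by (auto simp: W_def)
  have "AE t in lebesgue. t \<in> {0<..<T} \<longrightarrow> (x has_vector_derivative A2 *v x t + e2) (at t)"
    using filippov_solutionD(3)[OF x]
  proof eventually_elim
    case (elim t)
    show ?case
    proof
      assume t: "t \<in> {0<..<T}"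
      obtain v where v: "v \<in> pwa_map A1 A2 e1 e2 c f (x t)" "(x has_vector_derivative v) (at t)"
        using elim by blast
      obtain m where m: "0 \<le> m" "m \<le> 1" "v = A2 *v x t + e2 + m *\<^sub>R ((A1 - A2) *v x t + (e1 - e2))"
        "m = 0 \<or> c \<bullet> x t + f = 0" "c \<bullet> x t + f = 0 \<Longrightarrow> c \<bullet> v = 0"
        using pwa_velocity_nonneg_side[OF nonneg t v] by blast
      have "c \<bullet> v = m * (c \<bullet> (A1 *v x t + e1)) + (1 - m) * (c \<bullet> (A2 *v x t + e2))"
        unfolding m(3) by (simp add: algebra_simps matrix_vector_mult_diff_rdistrib)
      moreover have "c \<bullet> (A1 *v x t + e1) > 0" "c \<bullet> (A2 *v x t + e2) > 0"
        using T(2)[of t] t by (auto simp: W_def)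
      ultimately have "c \<bullet> v > 0"
        using m(1,2) by (cases "m = 0") (auto intro!: add_pos_nonneg)
      then have "m = 0" using m(4,5) by auto
      then show "(x has_vector_derivative A2 *v x t + e2) (at t)" using v(2) m(3) by simp
    qed
  qed
  moreover have "norm (x t) \<le> norm \<xi> + 1" if "t \<in> {0..T}" for t
    using T(2)[OF that] by (simp add: W_def)
  ultimately show ?thesis using T(1) by blast
qed

text \<open>The sign of the second normal velocity separates crossing from sliding or tangency. Off
  the plane or when crossing, the second mode drives both solutions; otherwise
  \<open>c \<bullet> h\<close> is positive and the reflected flow applies.\<close>

lemma filippov_right_unique_nonneg_side:
  fixes A1 A2 :: "real^'n^'n"
  assumes x: "filippov_solution (pwa_map A1 A2 e1 e2 c f) \<xi> x"
    and z: "filippov_solution (pwa_map A1 A2 e1 e2 c f) \<xi> z"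
    and side: "c \<bullet> \<xi> + f > 0 \<or> c \<bullet> \<xi> + f = 0 \<and> c \<bullet> (A1 *v \<xi> + e1) > 0"
  shows "\<exists>\<epsilon>>0. \<forall>t\<in>{0..<\<epsilon>}. x t = z t"
proof (cases "c \<bullet> \<xi> + f > 0 \<or> c \<bullet> (A2 *v \<xi> + e2) > 0")
  case True
  then have side': "c \<bullet> \<xi> + f > 0 \<or> c \<bullet> \<xi> + f = 0 \<and> c \<bullet> (A1 *v \<xi> + e1) > 0 \<and> c \<bullet> (A2 *v \<xi> + e2) > 0"
    using side by auto
  obtain Tx where Tx: "Tx > 0" "\<And>t. t \<in> {0..Tx} \<Longrightarrow> norm (x t) \<le> norm \<xi> + 1"
    "AE t in lebesgue. t \<in> {0<..<Tx} \<longrightarrow> (x has_vector_derivative A2 *v x t + e2) (at t)"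
    using filippov_affine_near[OF x side'] by blast
  obtain Tz where Tz: "Tz > 0" "\<And>t. t \<in> {0..Tz} \<Longrightarrow> norm (z t) \<le> norm \<xi> + 1"
    "AE t in lebesgue. t \<in> {0<..<Tz} \<longrightarrow> (z has_vector_derivative A2 *v z t + e2) (at t)"
    using filippov_affine_near[OF z side'] by blast
  define T where "T = min Tx Tz"
  have T: "T > 0" "T \<le> Tx" "T \<le> Tz" using Tx(1) Tz(1) by (auto simp: T_def)
  show ?thesis
  proof (rule affine_flow_right_unique[where T = T and R = "norm \<xi> + 1"])
    show "bounded_linear ((*v) A2)" by (rule matrix_vector_mul_bounded_linear)
    show "AE t in lebesgue. t \<in> {0<..<T} \<longrightarrow> (x has_vector_derivative A2 *v x t + e2) (at t)"
      using Tx(3) by eventually_elim (use T in auto)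
    show "AE t in lebesgue. t \<in> {0<..<T} \<longrightarrow> (z has_vector_derivative A2 *v z t + e2) (at t)"
      using Tz(3) by eventually_elim (use T in auto)
    show "abs_continuous_on_interval x 0 T" "abs_continuous_on_interval z 0 T"
      using T filippov_solutionD(1)[OF x, of 0 T] filippov_solutionD(1)[OF z, of 0 T] by simp_all
    show "x 0 = z 0" using filippov_solutionD(2)[OF x] filippov_solutionD(2)[OF z] by simp
    show "norm (x t) \<le> norm \<xi> + 1" "norm (z t) \<le> norm \<xi> + 1" if "t \<in> {0..T}" for t
      using that T by (auto intro: Tx(2) Tz(2))
  qed (rule T(1))
next
  case False
  then have y0: "c \<bullet> \<xi> + f = 0" and g1: "c \<bullet> (A1 *v \<xi> + e1) > 0" and g2: "c \<bullet> (A2 *v \<xi> + e2) \<le> 0"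
    using side by auto
  define h where "h v = (A1 - A2) *v v + (e1 - e2)" for v
  \<comment> \<open>Half the value at the initial state leaves a uniform positive lower bound on a
    neighbourhood.\<close>
  define \<delta> where "\<delta> = (c \<bullet> h \<xi>) / 2"
  have ch: "c \<bullet> h v = c \<bullet> (A1 *v v + e1) - c \<bullet> (A2 *v v + e2)" for v
    by (simp add: h_def algebra_simps matrix_vector_mult_diff_rdistrib)
  have \<delta>: "\<delta> > 0" using g1 g2 by (simp add: \<delta>_def ch)
  \<comment> \<open>The second normal velocity may vanish at \<open>\<xi>\<close>, so
    \<open>W\<close> constrains it only through \<open>c \<bullet> h\<close>.\<close>
  define W where "W = {v. norm v < norm \<xi> + 1 \<and> 0 < c \<bullet> (A1 *v v + e1) \<and> \<delta> < c \<bullet> h v}"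
  have "open W" unfolding W_def h_def by (intro open_Collect_conj open_Collect_less continuous_intros)
  moreover have "\<xi> \<in> W" using g1 \<delta> by (simp add: W_def \<delta>_def)
  ultimately have near: "\<exists>T>0. \<forall>t\<in>{0..T}. u t \<in> W"
    if "filippov_solution (pwa_map A1 A2 e1 e2 c f) \<xi> u" for u
    using filippov_solution_stays[OF that] by blast
  obtain Tx where Tx: "Tx > 0" "\<And>t. t \<in> {0..Tx} \<Longrightarrow> x t \<in> W" using near[OF x] by blast
  obtain Tz where Tz: "Tz > 0" "\<And>t. t \<in> {0..Tz} \<Longrightarrow> z t \<in> W" using near[OF z] by blast
  define T where "T = min Tx Tz"
  have T: "T > 0" and xW: "\<And>t. t \<in> {0..T} \<Longrightarrow> x t \<in> W" and zW: "\<And>t. t \<in> {0..T} \<Longrightarrow> z t \<in> W"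
    using Tx Tz by (auto simp: T_def)
  have xn: "c \<bullet> x t + f \<ge> 0" if "t \<in> {0..T}" for t
    using filippov_nonneg_side_invariant[OF x _ _ that] xW y0 by (auto simp: W_def)
  have zn: "c \<bullet> z t + f \<ge> 0" if "t \<in> {0..T}" for t
    using filippov_nonneg_side_invariant[OF z _ _ that] zW y0 by (auto simp: W_def)
  show ?thesis
  proof (rule reflected_flow_right_unique[where T = T and R = "norm \<xi> + 1" and \<delta> = \<delta> and c = c
        and H = "(*v) (A1 - A2)" and g = "e1 - e2" and A = "(*v) A2" and e = e2])
    show "bounded_linear ((*v) A2)" "bounded_linear ((*v) (A1 - A2))"
      by (rule matrix_vector_mul_bounded_linear)+
    show "AE t in lebesgue. t \<in> {0<..<T} \<longrightarrow> (\<exists>m \<rho>.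
        (x has_vector_derivative A2 *v x t + e2 + m *\<^sub>R ((A1 - A2) *v x t + (e1 - e2))) (at t) \<and>
        (z has_vector_derivative A2 *v z t + e2 + \<rho> *\<^sub>R ((A1 - A2) *v z t + (e1 - e2))) (at t) \<and>
        0 \<le> m \<and> m \<le> 1 \<and> 0 \<le> \<rho> \<and> \<rho> \<le> 1 \<and>
        (m = 0 \<or> c \<bullet> (x t - z t) \<le> 0) \<and> (\<rho> = 0 \<or> c \<bullet> (x t - z t) \<ge> 0))"
      using filippov_solutionD(3)[OF x] filippov_solutionD(3)[OF z]
    proof eventually_elim
      case (elim t)
      show ?case
      proof
        assume t: "t \<in> {0<..<T}"
        obtain v where v: "v \<in> pwa_map A1 A2 e1 e2 c f (x t)" "(x has_vector_derivative v) (at t)"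
          using elim by blast
        obtain v' where v': "v' \<in> pwa_map A1 A2 e1 e2 c f (z t)" "(z has_vector_derivative v') (at t)"
          using elim by blast
        obtain m where m: "0 \<le> m" "m \<le> 1" "v = A2 *v x t + e2 + m *\<^sub>R ((A1 - A2) *v x t + (e1 - e2))"
          "m = 0 \<or> c \<bullet> x t + f = 0"
          using pwa_velocity_nonneg_side[OF xn t v] by blast
        obtain \<rho> where \<rho>: "0 \<le> \<rho>" "\<rho> \<le> 1" "v' = A2 *v z t + e2 + \<rho> *\<^sub>R ((A1 - A2) *v z t + (e1 - e2))"
          "\<rho> = 0 \<or> c \<bullet> z t + f = 0"
          using pwa_velocity_nonneg_side[OF zn t v'] by blast
        \<comment> \<open>A multiplier is nonzero only on the plane, where \<open>y\<close> takes
          its least possible value along both solutions; the other solution cannot lie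
          lower.\<close>
        have "m = 0 \<or> c \<bullet> (x t - z t) \<le> 0" "\<rho> = 0 \<or> c \<bullet> (x t - z t) \<ge> 0"
          using m(4) \<rho>(4) xn[of t] zn[of t] t by (auto simp: inner_diff_right)
        then show "\<exists>m \<rho>.
          (x has_vector_derivative A2 *v x t + e2 + m *\<^sub>R ((A1 - A2) *v x t + (e1 - e2))) (at t) \<and>
          (z has_vector_derivative A2 *v z t + e2 + \<rho> *\<^sub>R ((A1 - A2) *v z t + (e1 - e2))) (at t) \<and>
          0 \<le> m \<and> m \<le> 1 \<and> 0 \<le> \<rho> \<and> \<rho> \<le> 1 \<and>
          (m = 0 \<or> c \<bullet> (x t - z t) \<le> 0) \<and> (\<rho> = 0 \<or> c \<bullet> (x t - z t) \<ge> 0)"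
          using m(1,2) \<rho>(1,2) v(2) v'(2) unfolding m(3) \<rho>(3) by blast
      qed
    qed
    show "norm (x t) \<le> norm \<xi> + 1" "norm (z t) \<le> norm \<xi> + 1"
      "\<delta> \<le> c \<bullet> ((A1 - A2) *v x t + (e1 - e2))" "\<delta> \<le> c \<bullet> ((A1 - A2) *v z t + (e1 - e2))"
      if "t \<in> {0..T}" for t
      using xW[OF that] zW[OF that] by (auto simp: W_def h_def)
    show "abs_continuous_on_interval x 0 T" "abs_continuous_on_interval z 0 T"
      using T filippov_solutionD(1)[OF x, of 0 T] filippov_solutionD(1)[OF z, of 0 T] by simp_all
    show "x 0 = z 0" using filippov_solutionD(2)[OF x] filippov_solutionD(2)[OF z] by simp
  qed (rule \<delta>, rule T)
qed

section \<open>Exchange of the modes and the lexicographic condition\<close>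

text \<open>Negating \<open>c\<close> and \<open>f\<close> exchanges the two half spaces. A negative
  second normal velocity becomes a positive first one, so treating one side is enough.\<close>

lemma pwa_map_swap: "pwa_map A2 A1 e2 e1 (- c) (- f) = pwa_map A1 A2 e1 e2 c f"
  by (rule ext) (auto simp: pwa_map_def insert_commute)

text \<open>For \<open>c \<noteq> 0\<close> the first rows force \<open>M $ 1 $ 1 = 1\<close>, so
  the first entries of the comparison agree and the second ones decide. On the plane
  \<open>M $ 2 $ 1\<close> multiplies \<open>c \<bullet> x + f = 0\<close>, which leaves the first
  normal velocity above \<open>M $ 2 $ 2\<close> times the second.\<close>

lemma lex_condition_normal_velocities:
  fixes A1 A2 :: "real^'n^'n" and M :: "real^2^2"
  assumes tri: "lower_triangular2 M" and pos: "M $ 2 $ 2 > 0"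
    and rows: "(vector [c, c v* A1] :: real^'n^2) = M ** vector [c, c v* A2]"
    and lex: "lex_greater (vector [f, c \<bullet> e1]) (M *v vector [f, c \<bullet> e2])"
    and surf: "c \<bullet> x + f = 0"
  shows "c \<bullet> (A1 *v x + e1) > 0 \<or> c \<bullet> (A2 *v x + e2) < 0"
proof (cases "c = 0")
  case True
  \<comment> \<open>With \<open>c = 0\<close>, a point on the plane forces \<open>f = 0\<close>;
    both sides of the strict comparison are then zero, a contradiction.\<close>
  then have "f = 0" "c \<bullet> e1 = 0" "c \<bullet> e2 = 0" using surf by simp_all
  then have "vector [f, c \<bullet> e1] = (0 :: real^2)" "vector [f, c \<bullet> e2] = (0 :: real^2)"
    by (simp_all add: vec_eq_iff forall_2)
  then show ?thesis using lex by (simp add: lex_greater_def lex_pos_def)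
next
  case False
  have M12: "M $ 1 $ 2 = 0" using tri by (simp add: lower_triangular2_def)
  have r1: "c = M $ 1 $ 1 *\<^sub>R c" and r2: "c v* A1 = M $ 2 $ 1 *\<^sub>R c + M $ 2 $ 2 *\<^sub>R (c v* A2)"
    using rows M12 by (simp_all add: vec_eq_iff forall_2 matrix_matrix_mult_def sum_2)
  have "M $ 1 $ 1 = 1" using r1 False by (metis scaleR_cancel_right scaleR_one)
  then have lex2: "c \<bullet> e1 > M $ 2 $ 1 * f + M $ 2 $ 2 * (c \<bullet> e2)"
    using lex M12 by (simp add: lex_greater_def lex_pos_def matrix_vector_mult_def sum_2)
  have "c \<bullet> (A1 *v x) = M $ 2 $ 1 * (c \<bullet> x) + M $ 2 $ 2 * (c \<bullet> (A2 *v x))"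
    unfolding dot_lmul_matrix[symmetric] r2 by (simp add: inner_add_left)
  moreover have "c \<bullet> x = - f" using surf by simp
  ultimately have "c \<bullet> (A1 *v x + e1) > M $ 2 $ 2 * (c \<bullet> (A2 *v x + e2))"
    using lex2 by (simp add: inner_add_right algebra_simps)
  then show ?thesis using mult_nonneg_nonneg[of "M $ 2 $ 2" "c \<bullet> (A2 *v x + e2)"] pos by linarith
qed

theorem theorem3p3:
  fixes A1 A2 :: "real^'n^'n" and e1 e2 c :: "real^'n" and f :: real
  assumes "\<exists>M :: real^2^2.
             lower_triangular2 M \<and> (\<forall>i. M $ i $ i > 0) \<and>
             (vector [c, c v* A1] :: real^'n^2) = M ** vector [c, c v* A2] \<and>
             lex_greater (vector [f, c \<bullet> e1]) (M *v vector [f, c \<bullet> e2])"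
  shows "\<forall>\<xi> x. filippov_solution (pwa_map A1 A2 e1 e2 c f) \<xi> x \<longrightarrow>
                right_unique_solution (pwa_map A1 A2 e1 e2 c f) \<xi> x"
proof (intro allI impI)
  fix \<xi> x assume x: "filippov_solution (pwa_map A1 A2 e1 e2 c f) \<xi> x"
  have surf: "c \<bullet> (A1 *v \<xi> + e1) > 0 \<or> c \<bullet> (A2 *v \<xi> + e2) < 0" if "c \<bullet> \<xi> + f = 0"
    using assms lex_condition_normal_velocities[OF _ _ _ _ that] by blast
  have "\<exists>\<epsilon>>0. \<forall>t\<in>{0..<\<epsilon>}. x t = z t"
    if z: "filippov_solution (pwa_map A1 A2 e1 e2 c f) \<xi> z" for z
  proof (cases "c \<bullet> \<xi> + f > 0 \<or> c \<bullet> \<xi> + f = 0 \<and> c \<bullet> (A1 *v \<xi> + e1) > 0")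
    case True
    then show ?thesis by (rule filippov_right_unique_nonneg_side[OF x z])
  next
    case False
    \<comment> \<open>These are the side conditions with the modes exchanged: the state lies
      strictly on the negative side, or it lies on the plane and the second normal velocity is
      negative.\<close>
    then have "- c \<bullet> \<xi> + - f > 0 \<or> - c \<bullet> \<xi> + - f = 0 \<and> - c \<bullet> (A2 *v \<xi> + e2) > 0"
      using surf by auto
    then show ?thesis
      by (intro filippov_right_unique_nonneg_side[of A2 A1 e2 e1 "- c" "- f" \<xi> x z])
        (simp_all only: pwa_map_swap x z)
  qed
  then show "right_unique_solution (pwa_map A1 A2 e1 e2 c f) \<xi> x"
    using x by (simp add: right_unique_solution_def)
qed

end
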